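(* Let $p>1$ be a real number and $n>1$ an integer, with $p$ and $n$ not both equal to $2$, and suppose that $p'=p/(p-1)$ is an integer. (1) If $p'$ and $n$ are both even, then $\sin_{p,n}$ is analytic on $\mathbb{R}$. (2) If $p'$ is even and $n$ is odd, then $\sin_{p,n}$ is analytic on the interval $\left(-\nu(p',n),\ \pi_{p,n}+\nu(p',n)\right)$. (3) If $p'$ is odd and $n$ is even, then $\sin_{p,n}$ is analytic on the interval $\left(-\frac12\pi_{p,n}-\mu(p',n),\ \frac12\pi_{p,n}+\mu(p',n)\right)$. (4) If $p'$ and $n$ are both odd, then $\sin_{p,n}$ is analytic on the interval $\left(-\nu(p',n),\ \frac12\pi_{p,n}+\mu(p',n)\right)$. Here "analytic on an interval" means that the real function $\sin_{p,n}$ extends to a real-analytic function on that interval. Furthermore, each interval given is the maximal interval on which $\sin_{p,n}$ is real-analytic (i.e. to which it extends real-analytically).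
   Context: For real $p>1$ and integer $n>1$ (not both equal to $2$), set $a_n=-\infty$ for $n$ odd and $a_n=-1$ for $n$ even, and let $$F_{p,n}(y)=\int_0^y \frac{1}{(1-t^n)^{1/p}}\,dt$$ for real $y\in(a_n,1]$ (and also for $y=-1$ when $n$ is even). Put $\pi_{p,n}:=2F_{p,n}(1)$. For $n$ odd, $F_{p,n}(-\infty):=\lim_{y\to-\infty}F_{p,n}(y)\in[-\infty,0)$. The function $F_{p,n}$ is strictly increasing, and the real function $\sin_{p,n}$ is defined as its inverse: $$\sin_{p,n}:=F_{p,n}^{-1}:\left[-\tfrac12\pi_{p,n},\tfrac12\pi_{p,n}\right]\to[-1,1]\ \text{ for } n \text{ even},\qquad \sin_{p,n}:=F_{p,n}^{-1}:\left(F_{p,n}(-\infty),\tfrac12\pi_{p,n}\right]\to(-\infty,1]\ \text{ for } n \text{ odd}.$$ The conjugate of $p$ is $p':=p/(p-1)$, so $\frac1p+\frac1{p'}=1$. Also $$\mu(m,n):=\int_1^\infty \frac{1}{(t^n-1)^{(m-1)/m}}\,dt,\qquad \nu(m,n):=\int_0^\infty \frac{1}{(1+t^n)^{(m-1)/m}}\,dt.$$ For $n$ odd, $F_{p,n}(-\infty)=-\nu(p',n)$. *)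

theory Defs
  imports "HOL-Analysis.Analysis"
begin

definition conj_exponent :: "real \<Rightarrow> real" where
  "conj_exponent p = p / (p - 1)"

text \<open>
  The integral below is oriented, so it is the negative of the integral over \<open>[y, 0]\<close> for
  \<open>y < 0\<close>. At the singular points \<open>t = 1\<close> (and \<open>t = -1\<close> for \<open>n\<close> even) the integrand takes
  the value 0 by the convention on division, which is irrelevant for the integral.
\<close>

definition F_pn :: "real \<Rightarrow> nat \<Rightarrow> real \<Rightarrow> real" where
  "F_pn p n y = (LBINT t=0..ereal y. 1 / (1 - t ^ n) powr (1 / p))"

definition F_dom :: "nat \<Rightarrow> real set" where
  "F_dom n = (if even n then {-1..1} else {..1})"

definition pi_pn :: "real \<Rightarrow> nat \<Rightarrow> real" where
  "pi_pn p n = 2 * F_pn p n 1"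

definition F_minf :: "real \<Rightarrow> nat \<Rightarrow> ereal" where
  "F_minf p n = Lim at_bot (\<lambda>y. ereal (F_pn p n y))"

definition sin_dom :: "real \<Rightarrow> nat \<Rightarrow> real set" where
  "sin_dom p n =
     (if even n then {- (pi_pn p n / 2)..pi_pn p n / 2}
      else {x. F_minf p n < ereal x \<and> x \<le> pi_pn p n / 2})"

text \<open>Only the values on \<open>sin_dom p n\<close> are meaningful.\<close>

definition sin_pn :: "real \<Rightarrow> nat \<Rightarrow> real \<Rightarrow> real" where
  "sin_pn p n = the_inv_into (F_dom n) (F_pn p n)"

text \<open>
  As usual, the Lebesgue integrals defining \<open>mu\<close> and \<open>nu\<close> are 0 if they diverge. For
  \<open>m > 1\<close> they converge iff \<open>n (m - 1) > m\<close>; this holds for all integers \<open>m, n \<ge> 2\<close>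
  other than \<open>m = n = 2\<close>.
\<close>

definition mu :: "real \<Rightarrow> nat \<Rightarrow> real" where
  "mu m n = (LBINT t=1..\<infinity>. 1 / (t ^ n - 1) powr ((m - 1) / m))"

definition nu :: "real \<Rightarrow> nat \<Rightarrow> real" where
  "nu m n = (LBINT t=0..\<infinity>. 1 / (1 + t ^ n) powr ((m - 1) / m))"

text \<open>
  Real-analyticity is required at every point of \<open>S\<close>, in a full neighbourhood of that point
  in \<open>\<real>\<close>, even if \<open>S\<close> is not open.
\<close>

definition real_analytic_on :: "(real \<Rightarrow> real) \<Rightarrow> real set \<Rightarrow> bool" where
  "real_analytic_on f S \<longleftrightarrow> (\<forall>x\<in>S. \<exists>A. (\<lambda>h. f (x + h)) has_fps_expansion A)"

text \<open>The set \<open>D\<close> is the domain of the partial function given by \<open>f\<close>.\<close>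

definition extends_analytically_to ::
    "(real \<Rightarrow> real) \<Rightarrow> real set \<Rightarrow> real set \<Rightarrow> bool" where
  "extends_analytically_to f D I \<longleftrightarrow>
     D \<subseteq> I \<and> (\<exists>g. real_analytic_on g I \<and> (\<forall>x\<in>D. g x = f x))"

text \<open>
  Maximality is meant in the strong sense: \<open>I\<close> contains every interval to which \<open>f\<close> extends
  analytically.
\<close>

definition maximal_analytic_interval ::
    "(real \<Rightarrow> real) \<Rightarrow> real set \<Rightarrow> real set \<Rightarrow> bool" where
  "maximal_analytic_interval f D I \<longleftrightarrow>
     is_interval I \<and> extends_analytically_to f D I \<and>
     (\<forall>J. is_interval J \<and> extends_analytically_to f D J \<longrightarrow> J \<subseteq> I)"

end

theory Submission
  imports Defs "HOL-Complex_Analysis.Complex_Analysis"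
begin

text \<open>
  Write \<open>k\<close> for the conjugate exponent of \<open>p\<close>, so that \<open>1 / p = 1 - 1 / k\<close>, and put
  \<open>s = sin_pn p n\<close>, \<open>c = (1 - s ^ n) powr (1 / k)\<close>. On the quarter period where \<open>s\<close> and \<open>c\<close> are
  positive they satisfy
  \<open>s' = c ^ (k - 1)\<close>, \<open>c' = - (n / k) * s ^ (n - 1)\<close>, \<open>s ^ n + c ^ k = 1\<close>.
  For integral \<open>k\<close> this is a polynomial vector field tangent to the curve \<open>X ^ n + Y ^ k = 1\<close>, and
  the system is symmetric in the two coordinates up to scaling and time reversal. Hence \<open>c\<close> is
  again a generalised sine: with \<open>q = n / (n - 1)\<close>,
  \<open>c x = sin_pn q k (n / k * (pi_pn p n / 2 - x))\<close>.
  
  This duality does all the work. The function \<open>sin_pn p n\<close> is the inverse of an integral with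
  analytic non-vanishing integrand as long as \<open>s ^ n < 1\<close>; at \<open>x = pi_pn p n / 2\<close> the integrand is
  singular, but there \<open>c\<close> passes through \<open>0\<close>, where the dual integrand is regular. So
  \<open>(1 - c ^ k) powr (1 / n)\<close>, with \<open>c\<close> given by the dual sine, is analytic across that point
  (\<open>upper_sin_analytic\<close>) and coincides with \<open>sin_pn p n\<close> to the left of it (\<open>upper_sin_eq\<close>). It
  lives until the dual sine reaches the left end of its own domain.
  
  For \<open>k\<close> odd the dual sine then tends to \<open>-\<infinity>\<close> and \<open>s\<close> to \<open>\<infinity>\<close>; substituting
  \<open>c = - ((u ^ n - 1) powr (1 / k))\<close> in the dual integral shows that this happens after the
  additional time \<open>mu k n\<close> (\<open>right_end_odd\<close>). For \<open>k\<close> even the dual sine is odd, and \<open>s\<close> is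
  symmetric about \<open>pi_pn p n / 2\<close>. On the other side, for \<open>n\<close> odd \<open>s\<close> tends to \<open>-\<infinity>\<close> at
  \<open>- nu k n\<close>, and for \<open>n\<close> even \<open>s\<close> is an odd function. The four cases combine these two
  alternatives; when both reflections are available they generate a periodic function.
  
  Maximality is automatic at a finite end point, because \<open>s\<close> is unbounded there: by the identity
  theorem any analytic continuation past that point would agree with \<open>s\<close> up to the point and
  would be continuous in it (\<open>real_analytic_extension_blowup\<close>).
\<close>

section \<open>Real-analytic functions of one variable\<close>

lemma real_analytic_on_iff_at:
  "real_analytic_on f S \<longleftrightarrow> (\<forall>x\<in>S. real_analytic_on f {x})"
  by (auto simp: real_analytic_on_def)

lemma real_analytic_at_cong:
  assumes "real_analytic_on g {x}" and "eventually (\<lambda>t. f t = g t) (nhds x)"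
  shows "real_analytic_on f {x}"
proof -
  from assms(1) obtain A where A: "(\<lambda>h. g (x + h)) has_fps_expansion A"
    by (auto simp: real_analytic_on_def)
  have "((\<lambda>h. x + h) \<longlongrightarrow> x + 0) (nhds 0)"
    by (intro tendsto_intros filterlim_ident)
  then have "eventually (\<lambda>h. f (x + h) = g (x + h)) (nhds 0)"
    using assms(2) by (auto simp: filterlim_iff)
  then have "(\<lambda>h. f (x + h)) has_fps_expansion A"
    using A has_fps_expansion_cong[of "\<lambda>h. f (x + h)" "\<lambda>h. g (x + h)" A A] by simp
  then show ?thesis by (auto simp: real_analytic_on_def)
qed

lemma real_analytic_at_cong_open:
  assumes "real_analytic_on g {x}" "open U" "x \<in> U" "\<And>t. t \<in> U \<Longrightarrow> f t = g t"
  shows "real_analytic_on f {x}"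
  using assms(1)
proof (rule real_analytic_at_cong)
  have "eventually (\<lambda>t. t \<in> U) (nhds x)" using assms(2,3) by (rule eventually_nhds_in_open)
  then show "eventually (\<lambda>t. f t = g t) (nhds x)" by eventually_elim (rule assms(4))
qed

lemma real_analytic_at_imp_isCont:
  assumes "real_analytic_on f {x}"
  shows "isCont f x"
proof -
  from assms obtain A where "(\<lambda>h. f (x + h)) has_fps_expansion A"
    by (auto simp: real_analytic_on_def)
  then have "isCont (\<lambda>h. f (x + h)) 0"
    by (rule has_fps_expansion_imp_continuous)
  then show ?thesis
    by (simp add: isCont_def LIM_offset_zero_iff)
qed

lemma has_fps_expansion_scale_arg:
  fixes f :: "real \<Rightarrow> real" and c :: real
  assumes "f has_fps_expansion A" and "c \<noteq> 0"
  shows "(\<lambda>h. f (c * h)) has_fps_expansion (fps_compose A (fps_const c * fps_X))"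
proof -
  have nth: "fps_nth (fps_compose A (fps_const c * fps_X)) n = c ^ n * fps_nth A n" for n
    by (simp add: fps_compose_linear)
  have R: "fps_conv_radius A > 0" and ev: "eventually (\<lambda>z. eval_fps A z = f z) (nhds 0)"
    using assms(1) by (auto simp: has_fps_expansion_def)
  obtain r where r: "r > 0" "ereal r < fps_conv_radius A"
    using R ereal_dense2[of 0 "fps_conv_radius A"] by (auto simp: zero_ereal_def)
  have "summable (\<lambda>n. fps_nth A n * r ^ n)"
    by (rule summable_fps) (use r in auto)
  then have "summable (\<lambda>n. (c ^ n * fps_nth A n) * (r / c) ^ n)"
    using assms(2) by (simp add: power_divide field_simps)
  then have "conv_radius (\<lambda>n. c ^ n * fps_nth A n) \<ge> norm (r / c)"
    by (rule conv_radius_geI)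
  moreover have "0 < norm (r / c)" using r assms(2) by simp
  ultimately have "fps_conv_radius (fps_compose A (fps_const c * fps_X)) > 0"
    unfolding fps_conv_radius_def nth
    by (metis ereal_less(2) order_less_le_trans)
  moreover have "((\<lambda>h. c * h) \<longlongrightarrow> c * 0) (nhds 0)"
    by (intro tendsto_intros filterlim_ident)
  then have "eventually (\<lambda>h. eval_fps A (c * h) = f (c * h)) (nhds 0)"
    using ev by (auto simp: filterlim_iff)
  moreover have "eval_fps (fps_compose A (fps_const c * fps_X)) h = eval_fps A (c * h)" for h
    unfolding eval_fps_def nth by (simp add: power_mult_distrib mult_ac)
  ultimately show ?thesis by (simp add: has_fps_expansion_def)
qed

lemma real_analytic_at_affine:
  assumes "real_analytic_on f {a + c * x}" and "c \<noteq> 0"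
  shows "real_analytic_on (\<lambda>t. f (a + c * t)) {x}"
proof -
  from assms(1) obtain A where "(\<lambda>h. f (a + c * x + h)) has_fps_expansion A"
    by (auto simp: real_analytic_on_def)
  from has_fps_expansion_scale_arg[OF this assms(2)] show ?thesis
    by (auto simp: real_analytic_on_def algebra_simps)
qed

lemma real_analytic_at_cmult:
  assumes "real_analytic_on f {x}"
  shows "real_analytic_on (\<lambda>t. c * f t) {x}"
  using assms by (auto simp: real_analytic_on_def intro: has_fps_expansion_cmult_left)

lemma has_fps_expansion_Re:
  fixes Q :: "complex \<Rightarrow> complex"
  assumes "Q has_fps_expansion A"
  shows "(\<lambda>h::real. Re (Q (of_real h))) has_fps_expansion Abs_fps (\<lambda>n. Re (fps_nth A n))"
proof -
  define B where "B = Abs_fps (\<lambda>n. Re (fps_nth A n))"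
  have R: "fps_conv_radius A > 0" and ev: "eventually (\<lambda>z. eval_fps A z = Q z) (nhds 0)"
    using assms by (auto simp: has_fps_expansion_def)
  have sums: "(\<lambda>n. fps_nth B n * h ^ n) sums Re (eval_fps A (of_real h))"
    if "ereal \<bar>h\<bar> < fps_conv_radius A" for h
  proof -
    have "(\<lambda>n. fps_nth A n * of_real h ^ n) sums eval_fps A (of_real h)"
      by (rule sums_eval_fps) (use that in simp)
    then have "(\<lambda>n. Re (fps_nth A n * of_real h ^ n)) sums Re (eval_fps A (of_real h))"
      by (rule sums_Re)
    moreover have "(\<lambda>n. Re (fps_nth A n * of_real h ^ n)) = (\<lambda>n. fps_nth B n * h ^ n)"
      by (rule ext) (simp add: B_def flip: of_real_power)
    ultimately show ?thesis by (simp only:)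
  qed
  obtain r where r: "r > 0" "ereal r < fps_conv_radius A"
    using R ereal_dense2[of 0 "fps_conv_radius A"] by (auto simp: zero_ereal_def)
  have "summable (\<lambda>n. fps_nth B n * r ^ n)"
    using sums[of r] r by (auto simp: sums_iff)
  then have "conv_radius (fps_nth B) \<ge> norm r"
    by (rule conv_radius_geI)
  moreover have "0 < norm r" using r by simp
  ultimately have "fps_conv_radius B > 0"
    unfolding fps_conv_radius_def by (metis ereal_less(2) order_less_le_trans)
  moreover have "eventually (\<lambda>h. eval_fps B h = Re (Q (of_real h))) (nhds 0)"
  proof -
    have "((\<lambda>h::real. of_real h :: complex) \<longlongrightarrow> of_real 0) (nhds 0)"
      by (intro tendsto_intros filterlim_ident)
    then have "eventually (\<lambda>h::real. eval_fps A (of_real h) = Q (of_real h)) (nhds 0)"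
      using ev by (auto simp: filterlim_iff)
    moreover have "eventually (\<lambda>h. h \<in> ball 0 r) (nhds 0)"
      using r by (intro eventually_nhds_in_open) auto
    ultimately show ?thesis
    proof eventually_elim
      case (elim h)
      have "ereal \<bar>h\<bar> < fps_conv_radius A"
        using elim(2) r(2) order_less_trans[of "ereal \<bar>h\<bar>" "ereal r"] by simp
      from sums[OF this] elim(1) show ?case
        by (simp add: eval_fps_def sums_iff)
    qed
  qed
  ultimately show ?thesis by (simp add: has_fps_expansion_def B_def)
qed

text \<open>
  If \<open>f\<close> inverts a function \<open>G\<close> whose derivative extends to a holomorphic function \<open>H\<close> with
  \<open>H (f x0) \<noteq> 0\<close>, then a complex primitive of \<open>H\<close> has a local holomorphic inverse, and \<open>f\<close> is the
  restriction of that inverse to the real axis. The outer function \<open>K\<close> is carried along so that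
  expressions in \<open>f\<close> are covered without a composition theorem for real power series.
\<close>

lemma real_analytic_at_inverse_function:
  fixes G f K :: "real \<Rightarrow> real" and H KC :: "complex \<Rightarrow> complex"
  assumes S: "open S" "of_real (f x0) \<in> S"
    and H: "H holomorphic_on S" "H (of_real (f x0)) \<noteq> 0"
    and KC: "KC holomorphic_on S"
    and GK: "\<And>y. of_real y \<in> S \<Longrightarrow>
        \<exists>d. (G has_real_derivative d) (at y) \<and> H (of_real y) = of_real d \<and> KC (of_real y) = of_real (K y)"
    and f: "isCont f x0" and inv: "eventually (\<lambda>x. G (f x) = x) (nhds x0)"
  shows "real_analytic_on (\<lambda>x. K (f x)) {x0}"
proof -
  define y0 where "y0 = f x0"
  obtain e where e: "e > 0" "ball (of_real y0) e \<subseteq> S"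
    using S unfolding y0_def by (meson open_contains_ball)
  define B where "B = ball (of_real y0 :: complex) e"
  have B: "B \<subseteq> S" "open B" "of_real y0 \<in> B" "convex B" using e by (auto simp: B_def)
  have holH: "H holomorphic_on B" using H(1) B(1) by (rule holomorphic_on_subset)
  obtain P where P: "\<And>z. z \<in> B \<Longrightarrow> (P has_field_derivative H z) (at z within B)"
    by (rule holomorphic_convex_primitive'[OF B(4,2) holH]) (rule that)
  have P': "(P has_field_derivative H z) (at z)" if "z \<in> B" for z
    using P[OF that] unfolding at_within_open[OF that B(2)] .
  have Bre: "of_real y \<in> B \<longleftrightarrow> y \<in> ball y0 e" for y
    unfolding B_def mem_ball dist_of_real ..
  \<comment> \<open>On the real axis the complex primitive agrees with \<open>G\<close> up to a constant.\<close>
  have PG: "P (of_real y) - P (of_real y0) = of_real (G y - G y0)" if "y \<in> ball y0 e" for y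
  proof -
    have "((\<lambda>y. P (of_real y) - of_real (G y)) has_derivative (\<lambda>h. 0)) (at y within ball y0 e)"
      if "y \<in> ball y0 e" for y
    proof -
      from that have yB: "of_real y \<in> B" using Bre by simp
      then obtain d where d: "(G has_real_derivative d) (at y)" "H (of_real y) = of_real d"
        using GK B(1) by blast
      have "((\<lambda>y. P (of_real y)) has_vector_derivative of_real d) (at y)"
        using has_vector_derivative_real_field[OF P'[OF yB]] d(2) by simp
      moreover have "((\<lambda>y. of_real (G y) :: complex) has_vector_derivative of_real d) (at y)"
        using d(1) by (metis has_real_derivative_iff_has_vector_derivative
          has_vector_derivative_of_real)
      ultimately have "((\<lambda>y. P (of_real y) - of_real (G y)) has_vector_derivative of_real d - of_real d) (at y)"
        by (rule has_vector_derivative_diff)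
      then show ?thesis
        by (auto simp: has_vector_derivative_def intro: has_derivative_at_withinI)
    qed
    then have "\<exists>c. \<forall>y\<in>ball y0 e. P (of_real y) - of_real (G y) = c"
      by (rule has_derivative_zero_constant[OF convex_ball])
    then obtain c where c: "\<And>y. y \<in> ball y0 e \<Longrightarrow> P (of_real y) - of_real (G y) = c"
      by auto
    from c[OF that] c[of y0] e(1) show ?thesis
      by (simp add: algebra_simps)
  qed
  have holP: "P holomorphic_on B" using P B(2) by (auto simp: holomorphic_on_def field_differentiable_def)
  have dP: "deriv P (of_real y0) \<noteq> 0"
    using DERIV_imp_deriv[OF P'[OF B(3)]] H(2) by (simp add: y0_def)
  obtain r where r: "r > 0" "ball (of_real y0) r \<subseteq> B"
      "open (P ` ball (of_real y0) r)" "inj_on P (ball (of_real y0) r)"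
    by (rule has_complex_derivative_locally_invertible[OF holP B(3,2) dP]) (rule that)
  define U where "U = ball (of_real y0 :: complex) r"
  obtain g where g: "g holomorphic_on (P ` U)" "\<And>z. z \<in> U \<Longrightarrow> g (P z) = z"
  proof (rule holomorphic_has_inverse)
    show "P holomorphic_on U" using holP r(2) unfolding U_def by (rule holomorphic_on_subset)
    show "open U" "inj_on P U" using r(4) by (auto simp: U_def)
  qed (rule that)
  have gim: "g ` (P ` U) \<subseteq> S" using g(2) r(2) B(1) by (auto simp: U_def)
  define Q where "Q = (\<lambda>h. KC (g (P (of_real y0) + h)))"
  have "(KC \<circ> g) holomorphic_on (P ` U)"
    using g(1) KC gim by (intro holomorphic_on_compose) (auto intro: holomorphic_on_subset)
  moreover have "P (of_real y0) \<in> P ` U" using r(1) by (auto simp: U_def)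
  ultimately have "(KC \<circ> g) analytic_on {P (of_real y0)}"
    using r(3) analytic_at unfolding U_def by blast
  then obtain A where A: "Q has_fps_expansion A"
    using analytic_at_imp_has_fps_expansion unfolding Q_def o_def by blast
  have ev: "eventually (\<lambda>x. K (f x) = Re (Q (of_real (x - x0)))) (nhds x0)"
  proof -
    have "(f \<longlongrightarrow> y0) (nhds x0)"
      using f unfolding y0_def by (simp add: continuous_at tendsto_at_iff_tendsto_nhds)
    then have "eventually (\<lambda>x. f x \<in> ball y0 (min r e)) (nhds x0)"
      using r e by (intro topological_tendstoD) auto
    with inv show ?thesis
    proof eventually_elim
      case (elim x)
      have "G y0 = x0" using eventually_nhds_x_imp_x[OF inv] by (simp add: y0_def)
      then have "P (of_real (f x)) = P (of_real y0) + of_real (x - x0)"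
        using PG[of "f x"] elim by (simp add: algebra_simps)
      moreover have "of_real (f x) \<in> U" using elim by (simp add: U_def dist_of_real)
      ultimately have "g (P (of_real y0) + of_real (x - x0)) = of_real (f x)"
        using g(2) by metis
      moreover have "of_real (f x) \<in> S" using elim e by (auto simp: dist_of_real subset_iff)
      ultimately show ?case using GK[of "f x"] by (auto simp: Q_def)
    qed
  qed
  have "real_analytic_on (\<lambda>x. Re (Q (of_real (x - x0)))) {x0}"
    using has_fps_expansion_Re[OF A] by (auto simp: real_analytic_on_def)
  then show ?thesis by (rule real_analytic_at_cong) (rule ev)
qed

section \<open>The identity theorem and maximality\<close>

lemma has_fps_expansion_real_isolated_zero:
  fixes f :: "real \<Rightarrow> real"
  assumes f: "f has_fps_expansion A" and "frequently (\<lambda>h. f h = 0) (at 0)"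
  shows "A = 0"
proof (rule ccontr)
  assume "A \<noteq> 0"
  \<comment> \<open>Dividing by the leading power of the argument leaves a function that is continuous and
      nonzero at \<open>0\<close>.\<close>
  define n where "n = subdegree A"
  define c where "c = fps_nth A n"
  have "c \<noteq> 0" using \<open>A \<noteq> 0\<close> by (simp add: c_def n_def)
  have "(\<lambda>x. if x = 0 then c else f x / x ^ n) has_fps_expansion fps_shift n A"
    using f by (rule has_fps_expansion_shift) (simp_all add: n_def c_def)
  then have "isCont (\<lambda>x. if x = 0 then c else f x / x ^ n) 0"
    by (rule has_fps_expansion_imp_continuous)
  then have "((\<lambda>x. if x = 0 then c else f x / x ^ n) \<longlongrightarrow> c) (at 0)"
    by (simp add: isCont_def)
  then have "eventually (\<lambda>x. (if x = 0 then c else f x / x ^ n) \<noteq> 0) (at 0)"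
    using \<open>c \<noteq> 0\<close> by (rule tendsto_imp_eventually_ne)
  then have "eventually (\<lambda>x. f x \<noteq> 0) (at 0)"
    by (rule eventually_mono[OF eventually_conj[OF _ eventually_neq_at_within[of 0]]])
       (auto split: if_splits)
  with assms(2) show False by (simp add: frequently_def)
qed

text \<open>
  The set where the two germs agree is open, and so is its complement in \<open>I\<close>, because the zeros
  of a nonzero power series are isolated.
\<close>

lemma real_analytic_identity:
  fixes f g :: "real \<Rightarrow> real"
  assumes I: "open I" "connected I" and f: "real_analytic_on f I" and g: "real_analytic_on g I"
    and U: "open U" "U \<noteq> {}" "U \<subseteq> I" and eq: "\<And>x. x \<in> U \<Longrightarrow> f x = g x"
    and x: "x \<in> I"
  shows "f x = g x"
proof -
  define E where "E = {x \<in> I. eventually (\<lambda>t. f t = g t) (nhds x)}"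
  have openE: "open E"
  proof (subst open_subopen, intro ballI)
    fix x assume "x \<in> E"
    then have "eventually (\<lambda>t. t \<in> I \<and> eventually (\<lambda>s. f s = g s) (nhds t)) (nhds x)"
      using I(1) by (intro eventually_conj eventually_nhds_in_open) (auto simp: E_def eventually_eventually)
    then show "\<exists>T. open T \<and> x \<in> T \<and> T \<subseteq> E"
      unfolding eventually_nhds E_def by blast
  qed
  have "open (I - E)"
  proof (subst open_subopen, intro ballI)
    fix x assume x: "x \<in> I - E"
    obtain A1 A2 where "(\<lambda>h. f (x + h)) has_fps_expansion A1" "(\<lambda>h. g (x + h)) has_fps_expansion A2"
      using f g x unfolding real_analytic_on_def by blast
    then obtain A where A: "(\<lambda>h. f (x + h) - g (x + h)) has_fps_expansion A"
      using has_fps_expansion_diff by blast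
    have "A \<noteq> 0"
    proof
      assume "A = 0"
      with A have "eventually (\<lambda>h. f (x + h) = g (x + h)) (nhds 0)"
        by (auto simp: has_fps_expansion_def elim: eventually_mono)
      moreover have "((\<lambda>t. t - x) \<longlongrightarrow> x - x) (nhds x)"
        by (intro tendsto_intros filterlim_ident)
      then have "filterlim (\<lambda>t. t - x) (nhds 0) (nhds x)" by simp
      ultimately have "eventually (\<lambda>t. f (x + (t - x)) = g (x + (t - x))) (nhds x)"
        by (rule eventually_compose_filterlim)
      then have "eventually (\<lambda>t. f t = g t) (nhds x)"
        by simp
      with x show False by (simp add: E_def)
    qed
    with A has_fps_expansion_real_isolated_zero
    have "eventually (\<lambda>h. f (x + h) - g (x + h) \<noteq> 0) (at 0)"
      unfolding frequently_def by blast
    then have "eventually (\<lambda>t. f t \<noteq> g t) (at x)"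
      by (subst at_to_0) (simp add: eventually_filtermap add.commute)
    then obtain T where T: "open T" "x \<in> T" "\<And>t. t \<in> T \<Longrightarrow> t \<noteq> x \<Longrightarrow> f t \<noteq> g t"
      by (auto simp: eventually_at_topological)
    have "T \<inter> I \<subseteq> I - E"
      using T x by (auto simp: E_def dest: eventually_nhds_x_imp_x)
    moreover have "open (T \<inter> I)" "x \<in> T \<inter> I" using T I x by auto
    ultimately show "\<exists>T. open T \<and> x \<in> T \<and> T \<subseteq> I - E" by blast
  qed
  moreover have "E \<noteq> {}"
  proof -
    obtain u where "u \<in> U" using U by blast
    moreover from this have "eventually (\<lambda>t. t \<in> U) (nhds u)"
      using U by (intro eventually_nhds_in_open)
    then have "eventually (\<lambda>t. f t = g t) (nhds u)"
      by eventually_elim (rule eq)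
    ultimately show ?thesis using U by (auto simp: E_def)
  qed
  ultimately have "I - E = {}"
    using connectedD[OF I(2) openE, of "I - E"] by (auto simp: E_def)
  then have "x \<in> E" using x by blast
  then show ?thesis by (auto simp: E_def dest: eventually_nhds_x_imp_x)
qed

text \<open>
  By the identity theorem, a continuation \<open>g\<close> of \<open>s\<close> defined at an end point would equal \<open>s\<close>
  all the way up to it, and then continuity of \<open>g\<close> there contradicts the blow-up of \<open>s\<close>.
  The set \<open>J\<close> contains such an end point as soon as it is not contained in the half-line,
  since it is an interval that meets \<open>{a<..<b}\<close>.
\<close>

lemma real_analytic_extension_blowup:
  fixes g s :: "real \<Rightarrow> real"
  assumes J: "is_interval J" "real_analytic_on g J"
    and s: "real_analytic_on s {a<..<b}"
    and D: "c < d" "{c<..<d} \<subseteq> J" "{c<..<d} \<subseteq> {a<..<b}" "\<And>x. x \<in> {c<..<d} \<Longrightarrow> g x = s x"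
  shows "filterlim s at_infinity (at_right a) \<Longrightarrow> J \<subseteq> {a<..}"
    and "filterlim s at_infinity (at_left b) \<Longrightarrow> J \<subseteq> {..<b}"
proof -
  have ab: "a \<le> c" "d \<le> b" using D(1,3) by (auto simp: greaterThanLessThan_subseteq_greaterThanLessThan)
  have cont: "isCont g x" if "x \<in> J" for x
    using J(2) that real_analytic_at_imp_isCont real_analytic_on_iff_at by blast
  have mid: "(c + d) / 2 \<in> {c<..<d}" using D(1) by auto
  have Jlow: "y \<in> J" if "x \<in> J" "x \<le> y" "y < d" for x y
  proof (cases "y > c")
    case False
    with that mid have "x \<le> y" "y \<le> (c + d) / 2" by auto
    then show ?thesis
      using mem_is_interval_1_I[OF J(1), of x "(c+d)/2" y] that(1) mid D(2) by blast
  qed (use that D in auto)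
  have Jhigh: "y \<in> J" if "x \<in> J" "y \<le> x" "c < y" for x y
  proof (cases "y < d")
    case False
    with that mid have "y \<le> x" "(c + d) / 2 \<le> y" by auto
    then show ?thesis
      using mem_is_interval_1_I[OF J(1), of "(c+d)/2" x y] that(1) mid D(2) by blast
  qed (use that D in auto)
  show "J \<subseteq> {a<..}" if lim: "filterlim s at_infinity (at_right a)"
  proof (rule ccontr)
    assume "\<not> J \<subseteq> {a<..}"
    then obtain x where x: "x \<in> J" "x \<le> a" by force
    have aJ: "a \<in> J" by (rule Jlow[OF x]) (use ab D(1) in auto)
    have gs: "g t = s t" if "t \<in> {a<..<d}" for t
    proof (rule real_analytic_identity[of "{a<..<d}" g s "{c<..<d}"])
      show "real_analytic_on g {a<..<d}" "real_analytic_on s {a<..<d}"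
        using J(2) s ab Jlow[OF aJ] by (auto simp: real_analytic_on_def)
    qed (use D ab that in auto)
    have "eventually (\<lambda>t. t \<in> {a<..<d}) (at_right a)"
      using ab D(1) by (intro eventually_at_right_real) auto
    then have "eventually (\<lambda>t. g t = s t) (at_right a)"
      by eventually_elim (rule gs)
    then have "filterlim g at_infinity (at_right a)"
      using lim by (simp add: filterlim_cong)
    moreover have "(g \<longlongrightarrow> g a) (at_right a)"
      using cont[OF aJ] by (simp add: isCont_def filterlim_at_split)
    ultimately show False
      using not_tendsto_and_filterlim_at_infinity trivial_limit_at_right_real by blast
  qed
  show "J \<subseteq> {..<b}" if lim: "filterlim s at_infinity (at_left b)"
  proof (rule ccontr)
    assume "\<not> J \<subseteq> {..<b}"
    then obtain x where x: "x \<in> J" "b \<le> x" by force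
    have bJ: "b \<in> J" by (rule Jhigh[OF x]) (use ab D(1) in auto)
    have gs: "g t = s t" if "t \<in> {c<..<b}" for t
    proof (rule real_analytic_identity[of "{c<..<b}" g s "{c<..<d}"])
      show "real_analytic_on g {c<..<b}" "real_analytic_on s {c<..<b}"
        using J(2) s ab Jhigh[OF bJ] by (auto simp: real_analytic_on_def)
    qed (use D ab that in auto)
    have "eventually (\<lambda>t. t \<in> {c<..<b}) (at_left b)"
      using ab D(1) by (intro eventually_at_left_real) auto
    then have "eventually (\<lambda>t. g t = s t) (at_left b)"
      by eventually_elim (rule gs)
    then have "filterlim g at_infinity (at_left b)"
      using lim by (simp add: filterlim_cong)
    moreover have "(g \<longlongrightarrow> g b) (at_left b)"
      using cont[OF bJ] by (simp add: isCont_def filterlim_at_split)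
    ultimately show False
      using not_tendsto_and_filterlim_at_infinity trivial_limit_at_left_real by blast
  qed
qed

lemma maximal_analytic_intervalI_blowup:
  assumes "real_analytic_on s {a<..<b}" and "D \<subseteq> {a<..<b}" and "\<And>x. x \<in> D \<Longrightarrow> s x = f x"
    and D: "c < d" "{c<..<d} \<subseteq> D"
    and "filterlim s at_infinity (at_right a)" and "filterlim s at_infinity (at_left b)"
  shows "maximal_analytic_interval f D {a<..<b}"
  unfolding maximal_analytic_interval_def
proof (intro conjI allI impI)
  show "is_interval {a<..<b}" by (rule is_interval_oo)
  show "extends_analytically_to f D {a<..<b}"
    unfolding extends_analytically_to_def using assms(1-3) by blast
  fix J assume J: "is_interval J \<and> extends_analytically_to f D J"
  then obtain g where g: "D \<subseteq> J" "real_analytic_on g J" "\<And>x. x \<in> D \<Longrightarrow> g x = f x"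
    by (auto simp: extends_analytically_to_def)
  have sub: "{c<..<d} \<subseteq> J" "{c<..<d} \<subseteq> {a<..<b}" "\<And>x. x \<in> {c<..<d} \<Longrightarrow> g x = s x"
    using D(2) assms(2,3) g by (fastforce)+
  have "J \<subseteq> {a<..}" "J \<subseteq> {..<b}"
    using real_analytic_extension_blowup[OF _ g(2) assms(1) D(1) sub] J assms(6,7) by blast+
  then show "J \<subseteq> {a<..<b}" by auto
qed

section \<open>The incomplete integral\<close>

text \<open>
  Used with \<open>F = at_left 1\<close> and \<open>F = at_top\<close> to obtain convergence of the improper integrals.
\<close>

lemma bounded_mono_converges:
  fixes f :: "real \<Rightarrow> real"
  assumes "c0 \<in> S"
    and mono: "\<And>x y. x \<in> S \<Longrightarrow> y \<in> S \<Longrightarrow> x \<le> y \<Longrightarrow> f x \<le> f y"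
    and bdd: "\<And>x. x \<in> S \<Longrightarrow> f x \<le> B"
    and cofinal: "\<And>c. c \<in> S \<Longrightarrow> eventually (\<lambda>x. x \<in> S \<and> c \<le> x) F"
  shows "\<exists>L. (f \<longlongrightarrow> L) F"
proof
  have bddS: "bdd_above (f ` S)" using bdd by (auto simp: bdd_above_def)
  show "(f \<longlongrightarrow> (SUP x\<in>S. f x)) F"
  proof (rule increasing_tendsto)
    show "eventually (\<lambda>x. f x \<le> (SUP x\<in>S. f x)) F"
      using cofinal[OF assms(1)] by eventually_elim (auto intro: cSUP_upper bddS)
    fix l assume "l < (SUP x\<in>S. f x)"
    then obtain c where c: "c \<in> S" "l < f c"
      using less_cSUP_iff[OF _ bddS] assms(1) by blast
    from cofinal[OF c(1)] show "eventually (\<lambda>x. l < f x) F"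
      by eventually_elim (use mono c in \<open>auto intro: order_less_le_trans\<close>)
  qed
qed

text \<open>
  The condition \<open>t ^ n < 1\<close> describes the interior of \<open>F_dom n\<close> for both parities at once, and it
  is the condition under which the integrand is regular.
\<close>

lemma power_less_one_iff_real:
  fixes t :: real
  assumes "n > 0"
  shows "t ^ n < 1 \<longleftrightarrow> (if even n then - 1 < t \<and> t < 1 else t < 1)"
proof (cases "even n")
  case True
  then have "t ^ n = \<bar>t\<bar> ^ n" by (simp add: power_even_abs)
  with True assms show ?thesis
    using power_less_one_iff[of "\<bar>t\<bar>" n] by (auto simp: abs_less_iff)
next
  case False
  then show ?thesis
    using power_less_one_iff[of t n] assms power_le_zero_eq[of t n]
    by (cases "t \<ge> 0") (auto intro: order_le_less_trans[of _ 0])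
qed

lemma F_dom_iff:
  assumes "n > 0"
  shows "t \<in> F_dom n \<longleftrightarrow> t ^ n < 1 \<or> t = 1 \<or> (even n \<and> t = - 1)"
  using assms by (auto simp: F_dom_def power_less_one_iff_real)

lemma power_less_one_between:
  fixes s t u :: real
  assumes "n > 0" "s ^ n < 1" "t ^ n < 1" "s \<le> u" "u \<le> t"
  shows "u ^ n < 1"
  using assms by (auto simp: power_less_one_iff_real split: if_splits)

lemma open_power_less_one: "open {t::real. t ^ n < 1}"
  by (intro open_Collect_less continuous_intros)

lemma isCont_F_integrand:
  fixes y :: real
  assumes "y ^ n < 1"
  shows "isCont (\<lambda>t. 1 / (1 - t ^ n) powr (1 / p)) y"
  using assms by (intro continuous_intros) auto

lemma F_pn_0: "F_pn p n 0 = 0"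
  by (simp add: F_pn_def zero_ereal_def[symmetric])

lemma F_pn_has_derivative:
  assumes "n > 0" and "y ^ n < 1"
  shows "(F_pn p n has_real_derivative 1 / (1 - y ^ n) powr (1 / p)) (at y)"
proof -
  obtain e where e: "e > 0" "ball y e \<subseteq> {t. t ^ n < 1}"
    using open_power_less_one[of n] assms(2) by (meson open_contains_ball mem_Collect_eq)
  define a where "a = min (y - e / 2) 0"
  define b where "b = max (y + e / 2) 0"
  have ab: "a \<le> 0" "0 \<le> b" "a < y" "y < b" using e(1) by (auto simp: a_def b_def)
  have "y - e / 2 \<in> ball y e" "y + e / 2 \<in> ball y e" using e(1) by (auto simp: dist_real_def)
  with e(2) have "(y - e / 2) ^ n < 1" "(y + e / 2) ^ n < 1" by blast+
  then have "a ^ n < 1" and "b ^ n < 1" using assms(1)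
    unfolding a_def b_def min_def max_def by (simp_all add: zero_power)
  then have less: "t ^ n < 1" if "t \<in> {a..b}" for t
    using that \<open>a ^ n < 1\<close> \<open>b ^ n < 1\<close> power_less_one_between[OF assms(1), of a b t] by simp
  have "continuous_on {a..b} (\<lambda>t. 1 / (1 - t ^ n) powr (1 / p))"
    using less isCont_F_integrand by (intro continuous_at_imp_continuous_on) blast
  from interval_integral_FTC2[OF ab(1,2) this, of y] ab
  have "((\<lambda>u. LBINT t=ereal 0..u. 1 / (1 - t ^ n) powr (1 / p)) has_vector_derivative
      1 / (1 - y ^ n) powr (1 / p)) (at y within {a..b})" by simp
  moreover have "at y within {a..b} = at y" using ab by (intro at_within_interior) (auto simp: interior_atLeastAtMost_real)
  ultimately show ?thesis
    by (simp add: has_real_derivative_iff_has_vector_derivative F_pn_def[abs_def] zero_ereal_def)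
qed

lemma F_pn_less_interior:
  assumes "n > 0" and "y ^ n < 1" "z ^ n < 1" "y < z"
  shows "F_pn p n y < F_pn p n z"
proof (rule DERIV_pos_imp_increasing[OF \<open>y < z\<close>])
  fix t assume "y \<le> t" "t \<le> z"
  with assms have t: "t ^ n < 1" using power_less_one_between by blast
  then have "1 / (1 - t ^ n) powr (1 / p) > 0" by simp
  with F_pn_has_derivative[OF assms(1) t] show "\<exists>d. DERIV (F_pn p n) t :> d \<and> d > 0" by blast
qed

text \<open>
  On \<open>[0, 1)\<close> one has \<open>t ^ n \<le> t\<close>, so the integrand is dominated by \<open>(1 - t) powr (- 1 / p)\<close>, whose
  integral over \<open>[0, 1]\<close> is \<open>1 / (1 - 1 / p)\<close>. The comparison is made between antiderivatives: the
  difference of the two is monotone.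
\<close>

lemma F_pn_le_conj_exponent:
  assumes "p > 1" "n > 0" "0 \<le> y" "y < 1"
  shows "F_pn p n y \<le> conj_exponent p"
proof -
  define r where "r = 1 / p"
  have r: "0 < r" "r < 1" using assms by (auto simp: r_def)
  define U where "U = (\<lambda>t. F_pn p n t + (1 - t) powr (1 - r) / (1 - r))"
  have "U y \<le> U 0"
  proof (rule DERIV_nonpos_imp_nonincreasing[OF assms(3)])
    fix t assume t: "0 \<le> t" "t \<le> y"
    with assms have t1: "t < 1" "t ^ n < 1" by (auto simp: power_less_one_iff)
    have "t ^ n \<le> t ^ 1" using assms t t1 by (intro power_decreasing) auto
    then have "(1 - t) powr r \<le> (1 - t ^ n) powr r" using t1 r by (intro powr_mono2) auto
    then have le: "1 / (1 - t ^ n) powr r \<le> 1 / (1 - t) powr r"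
      using t1 by (intro divide_left_mono) auto
    have "((\<lambda>t. (1 - t) powr (1 - r) / (1 - r)) has_real_derivative - ((1 - t) powr (- r))) (at t)"
    proof -
      have "((\<lambda>t. (1 - t) powr (1 - r)) has_real_derivative (1 - r) * (1 - t) powr (1 - r - 1) * - 1) (at t)"
        using t1 by (intro DERIV_chain'[OF _ has_real_derivative_powr]) (auto intro!: derivative_eq_intros)
      from DERIV_cdivide[OF this, of "1 - r"] r show ?thesis by simp
    qed
    with F_pn_has_derivative[OF assms(2) t1(2)]
    have "(U has_real_derivative 1 / (1 - t ^ n) powr r + - ((1 - t) powr (- r))) (at t)"
      unfolding U_def r_def by (intro DERIV_add) auto
    moreover have "1 / (1 - t ^ n) powr r + - ((1 - t) powr (- r)) \<le> 0"
      using le by (simp add: powr_minus_divide)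
    ultimately show "\<exists>d. DERIV U t :> d \<and> d \<le> 0" by blast
  qed
  moreover have "(1 - y) powr (1 - r) / (1 - r) \<ge> 0" using r by simp
  moreover have "1 / (1 - r) = conj_exponent p"
    using assms by (simp add: r_def conj_exponent_def field_simps)
  ultimately show ?thesis by (simp add: U_def F_pn_0)
qed

text \<open>
  The value at \<open>1\<close> is an improper integral. The antiderivative is monotone and bounded on
  \<open>[0, 1)\<close>, hence has a limit, which is the integral because the integrand is nonnegative.
\<close>

lemma F_pn_tendsto_1:
  assumes "p > 1" "n > 0"
  shows "(F_pn p n \<longlongrightarrow> pi_pn p n / 2) (at_left 1)"
proof -
  have less: "t ^ n < 1" if "0 \<le> t" "t < 1" for t :: real
    using that assms by (simp add: power_less_one_iff_real)
  have "\<exists>L. (F_pn p n \<longlongrightarrow> L) (at_left 1)"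
  proof (rule bounded_mono_converges[where S = "{0..<1}" and ?c0.0 = 0])
    fix x y :: real assume "x \<in> {0..<1}" "y \<in> {0..<1}" "x \<le> y"
    then show "F_pn p n x \<le> F_pn p n y"
      using F_pn_less_interior[of n x y p] less assms by (cases "x = y") auto
  next
    fix c :: real assume c: "c \<in> {0..<1}"
    then have "eventually (\<lambda>x. x \<in> {c<..<1}) (at_left 1)"
      by (intro eventually_at_left_real) auto
    then show "eventually (\<lambda>x. x \<in> {0..<1} \<and> c \<le> x) (at_left 1)"
      by eventually_elim (use c in auto)
  qed (use F_pn_le_conj_exponent[OF assms] in auto)
  then obtain L where L: "(F_pn p n \<longlongrightarrow> L) (at_left 1)" by blast
  have "isCont (F_pn p n) 0"
    using F_pn_has_derivative[of n 0 p] assms by (auto simp: zero_power intro: DERIV_isCont)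
  then have "(F_pn p n \<longlongrightarrow> 0) (at_right 0)"
    by (simp add: isCont_def F_pn_0 filterlim_at_split)
  then have "(LBINT t=ereal 0..ereal 1. 1 / (1 - t ^ n) powr (1 / p)) = L - 0"
    using L assms F_pn_has_derivative less isCont_F_integrand
    by (intro interval_integral_FTC_nonneg) (auto simp: ereal_tendsto_simps)
  then have "F_pn p n 1 = L" by (simp add: F_pn_def zero_ereal_def)
  with L show ?thesis by (simp add: pi_pn_def)
qed

lemma F_pn_1: "F_pn p n 1 = pi_pn p n / 2"
  by (simp add: pi_pn_def)

lemma F_pn_minus:
  assumes "even n"
  shows "F_pn p n (- y) = - F_pn p n y"
proof -
  have "F_pn p n (- y) = (LBINT t=ereal y..0. 1 / (1 - (- t) ^ n) powr (1 / p))"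
    unfolding F_pn_def using interval_integral_reflect[of 0 "ereal (- y)"] by simp
  also have "\<dots> = (LBINT t=ereal y..0. 1 / (1 - t ^ n) powr (1 / p))"
    using assms by (simp add: power_minus_even)
  also have "\<dots> = - F_pn p n y"
    unfolding F_pn_def by (rule interval_integral_endpoints_reverse)
  finally show ?thesis .
qed

lemma nu_conj_exponent:
  assumes "p > 1"
  shows "nu (conj_exponent p) n = (LBINT t=0..\<infinity>. 1 / (1 + t ^ n) powr (1 / p))"
proof -
  have "(conj_exponent p - 1) / conj_exponent p = 1 / p"
    using assms by (simp add: conj_exponent_def field_simps)
  then show ?thesis by (simp add: nu_def)
qed

text \<open>
  For \<open>n\<close> odd the reflection \<open>t \<mapsto> - t\<close> turns the integrand into that of \<open>nu\<close>. It is dominated by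
  \<open>t powr (- n / p)\<close> for \<open>t \<ge> 1\<close>, which is integrable at infinity since \<open>p < n\<close>.
\<close>

lemma F_pn_tendsto_at_bot:
  assumes "p > 1" "odd n" "p < n"
  shows "(F_pn p n \<longlongrightarrow> - nu (conj_exponent p) n) at_bot"
proof -
  define H where "H = (\<lambda>t. - F_pn p n (- t))"
  define h where "h = (\<lambda>t::real. 1 / (1 + t ^ n) powr (1 / p))"
  define \<rho> where "\<rho> = n / p"
  have n: "n > 0" using assms by (auto intro: Nat.gr0I)
  have \<rho>: "\<rho> > 1" using assms by (simp add: \<rho>_def)
  have neg: "(- t) ^ n < 1" if "t \<ge> 0" for t :: real
    using zero_le_power[OF that, of n] assms(2) by (simp add: power_minus_odd)
  have H': "(H has_real_derivative h t) (at t)" if "t \<ge> 0" for t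
  proof -
    have "((\<lambda>t. - F_pn p n (- t)) has_real_derivative
        - (1 / (1 - (- t) ^ n) powr (1 / p) * - 1)) (at t)"
      by (rule DERIV_minus, rule DERIV_chain'[where g = "F_pn p n"])
         (auto intro!: derivative_eq_intros F_pn_has_derivative neg that n)
    then show ?thesis using assms(2) by (simp add: H_def h_def power_minus_odd)
  qed
  have h_pos: "h t \<ge> 0" for t by (simp add: h_def)
  have H_mono: "H x \<le> H y" if "0 \<le> x" "x \<le> y" for x y
  proof (rule DERIV_nonneg_imp_nondecreasing[OF that(2)])
    fix t assume "x \<le> t"
    with that H'[of t] h_pos[of t] show "\<exists>d. DERIV H t :> d \<and> d \<ge> 0" by auto
  qed
  have H_bound: "H y \<le> H 1 + 1 / (\<rho> - 1)" if "1 \<le> y" for y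
  proof -
    define U where "U = (\<lambda>t. H t + t powr (1 - \<rho>) / (\<rho> - 1))"
    have "U y \<le> U 1"
    proof (rule DERIV_nonpos_imp_nonincreasing[OF that])
      fix t assume t: "1 \<le> t" "t \<le> y"
      have "((\<lambda>t. t powr (1 - \<rho>) / (\<rho> - 1)) has_real_derivative - (t powr (- \<rho>))) (at t)"
      proof -
        have "((\<lambda>t. t powr (1 - \<rho>)) has_real_derivative (1 - \<rho>) * t powr (1 - \<rho> - 1)) (at t)"
          using t by (intro has_real_derivative_powr) auto
        moreover have "(1 - \<rho>) * u / (\<rho> - 1) = - u" for u :: real
          using \<rho> by (simp add: field_simps)
        ultimately show ?thesis using DERIV_cdivide[of _ _ t UNIV "\<rho> - 1"] by fastforce
      qed
      with H'[of t] t have "(U has_real_derivative h t + - (t powr (- \<rho>))) (at t)"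
        unfolding U_def by (intro DERIV_add) auto
      moreover have "h t \<le> t powr (- \<rho>)"
      proof -
        have "(t ^ n) powr (1 / p) \<le> (1 + t ^ n) powr (1 / p)"
          using t assms by (intro powr_mono2) auto
        moreover have "(t ^ n) powr (1 / p) = t powr \<rho>"
          using t by (simp add: \<rho>_def powr_powr flip: powr_realpow)
        moreover have "0 < t powr \<rho>" using t by simp
        ultimately have "1 / (1 + t ^ n) powr (1 / p) \<le> 1 / t powr \<rho>"
          by (intro divide_left_mono mult_pos_pos) auto
        then show ?thesis by (simp add: h_def powr_minus_divide)
      qed
      ultimately show "\<exists>d. DERIV U t :> d \<and> d \<le> 0" by fastforce
    qed
    moreover have "y powr (1 - \<rho>) / (\<rho> - 1) \<ge> 0" using \<rho> by simp
    ultimately show ?thesis by (simp add: U_def)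
  qed
  have "\<exists>L. (H \<longlongrightarrow> L) at_top"
  proof (rule bounded_mono_converges[where S = "{1..}" and ?c0.0 = 1])
    fix c :: real assume "c \<in> {1..}"
    then show "eventually (\<lambda>x. x \<in> {1..} \<and> c \<le> x) at_top"
      by (intro eventually_mono[OF eventually_ge_at_top[of c]]) auto
  qed (use H_mono H_bound in auto)
  then obtain L where L: "(H \<longlongrightarrow> L) at_top" by blast
  have "isCont H 0" using H'[of 0] by (intro DERIV_isCont) auto
  then have "(H \<longlongrightarrow> 0) (at_right 0)"
    by (simp add: isCont_def H_def F_pn_0 filterlim_at_split)
  moreover have "isCont h t" if "t > 0" for t
  proof -
    have "1 + t ^ n > 0" using that by (intro add_pos_nonneg) auto
    then show ?thesis unfolding h_def by (intro continuous_intros) auto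
  qed
  ultimately have "(LBINT t=ereal 0..\<infinity>. h t) = L - 0"
    using L H' h_pos
    by (intro interval_integral_FTC_nonneg) (auto simp: ereal_tendsto_simps)
  then have "L = nu (conj_exponent p) n"
    using assms by (simp add: nu_conj_exponent h_def zero_ereal_def)
  moreover have "((\<lambda>t. - H (- t)) \<longlongrightarrow> - L) at_bot"
    by (intro tendsto_minus filterlim_compose[OF L] filterlim_uminus_at_top_at_bot)
  ultimately show ?thesis by (simp add: H_def)
qed

section \<open>The inverse function\<close>

text \<open>
  The infimum of the domain of \<open>sin_pn p n\<close> (which belongs to the domain iff \<open>n\<close> is even).
\<close>

definition sin_left_end :: "real \<Rightarrow> nat \<Rightarrow> real" where
  "sin_left_end p n = (if even n then - (pi_pn p n / 2) else - nu (conj_exponent p) n)"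

text \<open>
  The last hypothesis makes \<open>F_pn p n\<close> bounded below when its domain is unbounded. Below, the
  locale is used both for \<open>(p, n)\<close> and for the dual parameters.
\<close>

locale F_params =
  fixes p :: real and n :: nat
  assumes p: "p > 1" and n: "n > 1" and convergent: "even n \<or> p < n"
begin

lemma n_pos: "n > 0" using n by simp

text \<open>
  The filter is that of the left end of the interval \<open>{t. t ^ n < 1}\<close>; with it both parities are
  treated by the same argument in \<open>F_greater_left\<close> and \<open>F_surj\<close>.
\<close>

lemma F_tendsto_left_end:
  "(F_pn p n \<longlongrightarrow> sin_left_end p n) (if even n then at_right (- 1) else at_bot)"
proof (cases "even n")
  case True
  have "((\<lambda>t. - F_pn p n (- t)) \<longlongrightarrow> - (pi_pn p n / 2)) (at_right (- 1))"
  proof (intro tendsto_minus filterlim_compose[OF F_pn_tendsto_1[OF p n_pos]])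
    show "filterlim uminus (at_left 1) (at_right (- 1 :: real))"
      by (simp add: at_right_minus filterlim_def filtermap_filtermap)
  qed
  with True show ?thesis by (simp add: F_pn_minus sin_left_end_def)
next
  case False
  with convergent p F_pn_tendsto_at_bot show ?thesis by (simp add: sin_left_end_def)
qed

lemma F_less_right:
  assumes "y ^ n < 1"
  shows "F_pn p n y < pi_pn p n / 2"
proof -
  have "y < 1" using assms n_pos by (simp add: power_less_one_iff_real split: if_splits)
  then obtain z where z: "y < z" "z < 1" "z > 0" using dense[of "max y 0" 1] by auto
  then have zn: "z ^ n < 1" using n_pos by (simp add: power_less_one_iff)
  have "eventually (\<lambda>t. t \<in> {z<..<1}) (at_left 1)" using z by (intro eventually_at_left_real)
  then have "eventually (\<lambda>t. F_pn p n z \<le> F_pn p n t) (at_left 1)"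
  proof eventually_elim
    case (elim t)
    then have "t ^ n < 1" using z n_pos by (simp add: power_less_one_iff)
    with F_pn_less_interior[OF n_pos zn] elim show ?case by (simp add: less_imp_le)
  qed
  then have "F_pn p n z \<le> pi_pn p n / 2"
    by (intro tendsto_lowerbound[OF F_pn_tendsto_1[OF p n_pos]]) auto
  with F_pn_less_interior[OF n_pos assms zn z(1), of p] show ?thesis by simp
qed

lemma eventually_below:
  assumes "z ^ n < (1::real)"
  shows "eventually (\<lambda>t. t ^ n < 1 \<and> t < z) (if even n then at_right (- 1) else at_bot)"
proof (cases "even n")
  case True
  then have z: "- 1 < z" "z < 1" using assms n_pos by (auto simp: power_less_one_iff_real)
  then have "eventually (\<lambda>t. t \<in> {-1<..<z}) (at_right (- 1))" by (intro eventually_at_right_real)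
  then have "eventually (\<lambda>t. t ^ n < 1 \<and> t < z) (at_right (- 1))"
    by eventually_elim (use z True n_pos in \<open>auto simp: power_less_one_iff_real\<close>)
  with True show ?thesis by simp
next
  case False
  then have "z < 1" using assms n_pos by (auto simp: power_less_one_iff_real)
  have "eventually (\<lambda>t. t < z) at_bot" by (rule eventually_gt_at_bot)
  then have "eventually (\<lambda>t. t ^ n < 1 \<and> t < z) at_bot"
    by eventually_elim (use \<open>z < 1\<close> False n_pos in \<open>auto simp: power_less_one_iff_real\<close>)
  with False show ?thesis by simp
qed

lemma F_greater_left:
  assumes "y ^ n < 1"
  shows "sin_left_end p n < F_pn p n y"
proof -
  have nt: "(if even n then at_right (- 1) else at_bot :: real filter) \<noteq> bot" by simp
  obtain z where z: "z ^ n < 1" "z < y"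
    using eventually_happens'[OF nt eventually_below[OF assms]] by blast
  have "eventually (\<lambda>t. F_pn p n t \<le> F_pn p n z) (if even n then at_right (- 1) else at_bot)"
    using eventually_below[OF z(1)]
    by eventually_elim (use F_pn_less_interior[OF n_pos _ z(1)] in \<open>auto intro: less_imp_le\<close>)
  then have "sin_left_end p n \<le> F_pn p n z"
    by (intro tendsto_upperbound[OF F_tendsto_left_end _ nt])
  with F_pn_less_interior[OF n_pos z(1) assms z(2), of p] show ?thesis by simp
qed

lemma F_surj:
  assumes "sin_left_end p n < x" "x < pi_pn p n / 2"
  obtains y where "y ^ n < 1" "F_pn p n y = x"
proof -
  have nt: "(if even n then at_right (- 1) else at_bot :: real filter) \<noteq> bot" by simp
  have "eventually (\<lambda>t. t ^ n < 1 \<and> t < 0) (if even n then at_right (- 1) else at_bot :: real filter)"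
    using n_pos by (intro eventually_below) (simp add: zero_power)
  with order_tendstoD(2)[OF F_tendsto_left_end assms(1)]
  have "eventually (\<lambda>t. F_pn p n t < x \<and> t ^ n < 1 \<and> t < 0) (if even n then at_right (- 1) else at_bot)"
    by (rule eventually_conj)
  from eventually_happens'[OF nt this] obtain u where u: "F_pn p n u < x" "u ^ n < 1" "u < 0" by blast
  have "eventually (\<lambda>t. t \<in> {0<..<1::real}) (at_left 1)" by (intro eventually_at_left_real) simp
  with order_tendstoD(1)[OF F_pn_tendsto_1[OF p n_pos] assms(2)]
  have "eventually (\<lambda>t. x < F_pn p n t \<and> t \<in> {0<..<1}) (at_left 1)" by (rule eventually_conj)
  from eventually_happens'[OF _ this] obtain v where v: "x < F_pn p n v" "0 < v" "v < 1" by auto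
  have vn: "v ^ n < 1" using v n_pos by (simp add: power_less_one_iff)
  have less: "t ^ n < 1" if "u \<le> t" "t \<le> v" for t
    using power_less_one_between[OF n_pos u(2) vn that] .
  have "\<exists>y. u \<le> y \<and> y \<le> v \<and> F_pn p n y = x"
    by (rule IVT) (use u v less F_pn_has_derivative[OF n_pos] in \<open>auto intro: DERIV_isCont\<close>)
  then show ?thesis using that less by blast
qed

lemma F_left: "even n \<Longrightarrow> F_pn p n (- 1) = sin_left_end p n"
  by (simp add: F_pn_minus F_pn_1 sin_left_end_def)

lemma left_end_neg: "sin_left_end p n < 0" and pi_pos: "0 < pi_pn p n"
  using F_greater_left[of 0] F_less_right[of 0] n by (auto simp: F_pn_0 zero_power)

lemma inj_on_F: "inj_on (F_pn p n) (F_dom n)"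
proof -
  have "F_pn p n y < F_pn p n z" if yz: "y \<in> F_dom n" "z \<in> F_dom n" "y < z" for y z
  proof -
    consider "y ^ n < 1" "z ^ n < 1" | "y ^ n < 1" "z = 1" | "even n" "y = - 1" "z ^ n < 1"
      | "even n" "y = - 1" "z = 1"
      using yz unfolding F_dom_iff[OF n_pos] power_less_one_iff_real[OF n_pos]
      by (auto split: if_splits)
    then show ?thesis
      by cases (use yz F_pn_less_interior[OF n_pos] F_less_right F_greater_left F_left F_pn_1
          left_end_neg pi_pos in \<open>auto simp: F_pn_1 intro: order_less_trans\<close>)
  qed
  then show ?thesis by (intro inj_onI) (metis less_irrefl linorder_neqE_linordered_idom)
qed

lemma sin_F: "y ^ n < 1 \<Longrightarrow> sin_pn p n (F_pn p n y) = y"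
  unfolding sin_pn_def by (rule the_inv_into_f_f[OF inj_on_F]) (simp add: F_dom_iff n_pos)

lemma sin_right: "sin_pn p n (pi_pn p n / 2) = 1"
  unfolding sin_pn_def F_pn_1[symmetric]
  by (rule the_inv_into_f_f[OF inj_on_F]) (simp add: F_dom_iff n_pos)

lemma sin_left: "even n \<Longrightarrow> sin_pn p n (sin_left_end p n) = - 1"
  unfolding sin_pn_def
  by (subst F_left[symmetric], simp, rule the_inv_into_f_f[OF inj_on_F]) (simp add: F_dom_iff n_pos)

lemma sin_interior:
  assumes "sin_left_end p n < x" "x < pi_pn p n / 2"
  shows "sin_pn p n x ^ n < 1" "F_pn p n (sin_pn p n x) = x"
proof -
  obtain y where "y ^ n < 1" "F_pn p n y = x" using F_surj[OF assms] .
  then show "sin_pn p n x ^ n < 1" "F_pn p n (sin_pn p n x) = x" using sin_F by auto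
qed

lemma isCont_sin:
  assumes "sin_left_end p n < x" "x < pi_pn p n / 2"
  shows "isCont (sin_pn p n) x"
proof -
  define y where "y = sin_pn p n x"
  have y: "y ^ n < 1" "F_pn p n y = x" using sin_interior[OF assms] by (auto simp: y_def)
  have "\<exists>e>0. ball y e \<subseteq> {t. t ^ n < 1}"
    using open_power_less_one[of n] y(1) by (simp add: open_contains_ball)
  then obtain e where e: "e > 0" "ball y e \<subseteq> {t. t ^ n < 1}" by blast
  have "isCont (sin_pn p n) (F_pn p n y)"
  proof (rule isCont_inverse_function2[where f = "F_pn p n" and x = y and a = "y - e / 2" and b = "y + e / 2"])
    fix z assume "y - e / 2 \<le> z" "z \<le> y + e / 2"
    then have "z \<in> ball y e" using e(1) by (auto simp: dist_real_def)
    then have z: "z ^ n < 1" using e(2) by blast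
    show "sin_pn p n (F_pn p n z) = z" by (rule sin_F[OF z])
    show "isCont (F_pn p n) z" by (rule DERIV_isCont[OF F_pn_has_derivative[OF n_pos z]])
  qed (use e in auto)
  with y show ?thesis by simp
qed

lemma sin_dom_eq:
  "sin_dom p n = (if even n then {sin_left_end p n..pi_pn p n / 2} else {sin_left_end p n<..pi_pn p n / 2})"
proof (cases "even n")
  case False
  have "((\<lambda>y. ereal (F_pn p n y)) \<longlongrightarrow> ereal (sin_left_end p n)) at_bot"
    using F_tendsto_left_end False by (intro tendsto_ereal) simp
  then have "F_minf p n = ereal (sin_left_end p n)"
    unfolding F_minf_def by (intro tendsto_Lim) auto
  with False show ?thesis by (auto simp: sin_dom_def)
qed (simp add: sin_dom_def sin_left_end_def)

lemma sin_minus: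
  assumes "even n" "- (pi_pn p n / 2) \<le> x" "x \<le> pi_pn p n / 2"
  shows "sin_pn p n (- x) = - sin_pn p n x"
proof -
  have L: "sin_left_end p n = - (pi_pn p n / 2)" using assms by (simp add: sin_left_end_def)
  consider "x = - (pi_pn p n / 2)" | "x = pi_pn p n / 2" | "sin_left_end p n < x" "x < pi_pn p n / 2"
    using assms L by linarith
  then show ?thesis
  proof cases
    case 3
    then obtain y where y: "y ^ n < 1" "F_pn p n y = x" using F_surj by blast
    then have "(- y) ^ n < 1" "F_pn p n (- y) = - x" using assms(1) by (simp_all add: F_pn_minus)
    with y sin_F show ?thesis by metis
  next
    case 1
    then have "x = sin_left_end p n" "- x = pi_pn p n / 2" using L by auto
    then show ?thesis using sin_left[OF assms(1)] sin_right by (simp only: minus_minus)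
  next
    case 2
    then have "- x = sin_left_end p n" using L by auto
    then have "sin_pn p n (- x) = - 1" by (simp only: sin_left[OF assms(1)])
    moreover have "sin_pn p n x = 1" by (simp only: 2 sin_right)
    ultimately show ?thesis by simp
  qed
qed

lemma sin_strict_mono:
  assumes "sin_left_end p n < x" "x < y" "y < pi_pn p n / 2"
  shows "sin_pn p n x < sin_pn p n y"
proof (rule ccontr)
  assume "\<not> ?thesis"
  then have "sin_pn p n y \<le> sin_pn p n x" by simp
  then have "F_pn p n (sin_pn p n y) \<le> F_pn p n (sin_pn p n x)"
    using F_pn_less_interior[OF n_pos, of "sin_pn p n y" "sin_pn p n x" p] sin_interior(1) assms
    by (cases "sin_pn p n y = sin_pn p n x") (auto intro: less_imp_le)
  with sin_interior(2)[of x] sin_interior(2)[of y] assms show False by simp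
qed

lemma sin_tendsto_at_bot:
  assumes "odd n"
  shows "filterlim (sin_pn p n) at_bot (at_right (sin_left_end p n))"
  unfolding filterlim_at_bot
proof
  fix Z :: real
  define z where "z = min Z 0"
  have z: "z ^ n < 1" using assms n_pos by (simp add: power_less_one_iff_real z_def)
  then have "eventually (\<lambda>x. x \<in> {sin_left_end p n<..<F_pn p n z}) (at_right (sin_left_end p n))"
    using F_greater_left by (intro eventually_at_right_real)
  then show "eventually (\<lambda>x. sin_pn p n x \<le> Z) (at_right (sin_left_end p n))"
  proof eventually_elim
    case (elim x)
    then have "sin_pn p n x < sin_pn p n (F_pn p n z)"
      using F_less_right[OF z] by (intro sin_strict_mono) auto
    then show ?case using sin_F[OF z] by (simp add: z_def)
  qed
qed

text \<open>
  The integrand is continued to the complex domain where \<open>Re (z ^ n) < 1\<close>; there \<open>1 - z ^ n\<close> has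
  positive real part, so the principal branch of the power is holomorphic.
\<close>

lemma sin_analytic_compose:
  fixes K :: "real \<Rightarrow> real" and KC :: "complex \<Rightarrow> complex"
  assumes x: "sin_left_end p n < x" "x < pi_pn p n / 2"
    and KC: "KC holomorphic_on {z. z ^ n \<notin> {w. Re w \<ge> 1}}"
      "\<And>y. y ^ n < 1 \<Longrightarrow> KC (of_real y) = of_real (K y)"
  shows "real_analytic_on (\<lambda>t. K (sin_pn p n t)) {x}"
proof (rule real_analytic_at_inverse_function[where G = "F_pn p n" and f = "sin_pn p n" and K = K and KC = KC
      and S = "{z. z ^ n \<notin> {w. Re w \<ge> 1}}"
      and H = "\<lambda>z. 1 / (1 - z ^ n) powr of_real (1 / p)"])
  have Re_of: "Re (of_real y ^ n) = y ^ n" for y by (simp flip: of_real_power)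
  show "open {z::complex. z ^ n \<notin> {w. Re w \<ge> 1}}"
    by (simp add: not_le) (intro open_Collect_less continuous_intros)
  show "complex_of_real (sin_pn p n x) \<in> {z. z ^ n \<notin> {w. Re w \<ge> 1}}"
    using sin_interior(1)[OF x] Re_of by simp
  show "(\<lambda>z. 1 / (1 - z ^ n) powr complex_of_real (1 / p)) holomorphic_on {z. z ^ n \<notin> {w. Re w \<ge> 1}}"
    by (intro holomorphic_intros) (auto simp: complex_nonpos_Reals_iff powr_def)
  show "1 / (1 - complex_of_real (sin_pn p n x) ^ n) powr complex_of_real (1 / p) \<noteq> 0"
    using sin_interior(1)[OF x] by (simp add: powr_def del: of_real_power flip: of_real_power)
  show "\<exists>d. DERIV (F_pn p n) y :> d \<and> 1 / (1 - complex_of_real y ^ n) powr complex_of_real (1 / p) =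
       complex_of_real d \<and> KC (complex_of_real y) = complex_of_real (K y)"
    if "complex_of_real y \<in> {z. z ^ n \<notin> {w. Re w \<ge> 1}}" for y
  proof -
    have y: "y ^ n < 1" using that Re_of by simp
    have "1 - complex_of_real y ^ n = of_real (1 - y ^ n)" by simp
    then have "1 / (1 - complex_of_real y ^ n) powr complex_of_real (1 / p) =
       complex_of_real (1 / (1 - y ^ n) powr (1 / p))"
      using y powr_of_real[of "1 - y ^ n" "1 / p"] by simp
    with F_pn_has_derivative[OF n_pos y] KC(2)[OF y] show ?thesis by blast
  qed
  show "isCont (sin_pn p n) x" by (rule isCont_sin[OF x])
  have "eventually (\<lambda>t. t \<in> {sin_left_end p n<..<pi_pn p n / 2}) (nhds x)"
    using x by (intro eventually_nhds_in_open) auto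
  then show "eventually (\<lambda>t. F_pn p n (sin_pn p n t) = t) (nhds x)"
    by eventually_elim (auto intro: sin_interior)
qed (rule KC(1))

lemma sin_analytic:
  assumes "sin_left_end p n < x" "x < pi_pn p n / 2"
  shows "real_analytic_on (sin_pn p n) {x}"
  using sin_analytic_compose[OF assms, of "\<lambda>z. z" "\<lambda>y. y"] by (simp add: holomorphic_on_ident)

text \<open>
  For \<open>r = 1 / k\<close> with \<open>k\<close> conjugate to \<open>p\<close> this is the generalised cosine. Its instance for the
  dual parameters is the continuation of \<open>sin_pn p n\<close> beyond \<open>pi_pn p n / 2\<close>.
\<close>

lemma cos_analytic:
  assumes "sin_left_end p n < x" "x < pi_pn p n / 2"
  shows "real_analytic_on (\<lambda>t. (1 - sin_pn p n t ^ n) powr r) {x}"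
proof (rule sin_analytic_compose[OF assms, of "\<lambda>z. (1 - z ^ n) powr of_real r" "\<lambda>y. (1 - y ^ n) powr r"])
  show "(\<lambda>z. (1 - z ^ n) powr complex_of_real r) holomorphic_on {z. z ^ n \<notin> {w. Re w \<ge> 1}}"
    by (intro holomorphic_intros) (auto simp: complex_nonpos_Reals_iff)
  show "(1 - complex_of_real y ^ n) powr complex_of_real r = complex_of_real ((1 - y ^ n) powr r)"
    if "y ^ n < 1" for y
    using powr_of_real[of "1 - y ^ n" r] that by simp
qed

end

section \<open>Duality of sine and cosine\<close>

lemma filterlim_powr_at_top:
  assumes "filterlim f at_top F" and "(a::real) > 0"
  shows "filterlim (\<lambda>x. f x powr a) at_top F"
proof -
  have "filterlim (\<lambda>x. exp (a * ln (f x))) at_top F"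
    by (intro filterlim_compose[OF exp_at_top] filterlim_tendsto_pos_mult_at_top[OF tendsto_const assms(2)]
        filterlim_compose[OF ln_at_top assms(1)])
  moreover have "eventually (\<lambda>x. f x > 0) F"
    using assms(1) by (simp add: filterlim_at_top_dense)
  then have "eventually (\<lambda>x. f x powr a = exp (a * ln (f x))) F"
    by eventually_elim (simp add: powr_def)
  ultimately show ?thesis by (simp only: filterlim_cong[OF refl refl])
qed

locale curve_params =
  fixes p q :: real and n k :: nat
  assumes n: "n > 1" and k: "k > 1"
    and p_eq: "p = real k / (real k - 1)" and q_eq: "q = real n / (real n - 1)"

text \<open>
  If \<open>n\<close> is odd then \<open>n \<ge> 3\<close>, whereas \<open>k / (k - 1) \<le> 2\<close>.
\<close>

lemma F_params_from_exponents:
  assumes "n > 1" "k > 1"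
  shows "F_params (real k / (real k - 1)) n"
proof
  show "real k / (real k - 1) > 1" using assms by (simp add: field_simps)
  show "even n \<or> real k / (real k - 1) < real n"
  proof (cases "n = 2")
    case False
    then have "3 * (real k - 1) \<le> real n * (real k - 1)" using assms by (intro mult_right_mono) auto
    moreover have "real k \<ge> 2" using assms by simp
    ultimately have "real k < real n * (real k - 1)" by argo
    then show ?thesis using assms by (simp add: divide_less_eq)
  qed simp
qed (use assms in auto)

sublocale curve_params \<subseteq> F: F_params p n
  using F_params_from_exponents[OF n k] by (simp add: p_eq)

sublocale curve_params \<subseteq> G: F_params q k
  using F_params_from_exponents[OF k n] by (simp add: q_eq)

context curve_params
begin

lemma inverse_exponents: "1 / p = 1 - 1 / k" "1 / q = 1 - 1 / n"
  using n k by (auto simp: p_eq q_eq field_simps)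

lemma powr_root_power:
  assumes "x \<ge> 0"
  shows "(x powr (1 / k)) ^ k = x"
  using assms k by (cases "x = 0") (simp_all add: zero_power powr_powr flip: powr_realpow)

lemma power_powr_root:
  assumes "x \<ge> 0"
  shows "(x ^ n) powr (1 / n) = x"
  using assms n by (cases "x = 0") (simp_all add: zero_power powr_powr flip: powr_realpow)

text \<open>
  On \<open>s ^ n + c ^ k = 1\<close> the dual integrand at \<open>c\<close> is \<open>1 / (s ^ n) powr (1 / q)\<close>, and it cancels the
  factor \<open>s ^ (n - 1)\<close> of \<open>dc / ds\<close>.
\<close>

lemma power_powr_inverse_q: "x > 0 \<Longrightarrow> 1 / (x ^ n) powr (1 / q) * x ^ (n - 1) = (1 :: real)"
  using n by (auto simp: inverse_exponents powr_powr powr_diff of_nat_diff right_diff_distrib simp flip: powr_realpow)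

text \<open>
  Along the curve \<open>s ^ n + c ^ k = 1\<close> the forms \<open>ds / c ^ (k - 1)\<close> and \<open>- (k / n) * dc / s ^ (n - 1)\<close>
  agree. So the time from \<open>s = 0\<close> to the current point, measured in \<open>s\<close>, and the time from there
  to \<open>c = 0\<close>, measured in \<open>c\<close>, have a constant sum. The constant is found by letting \<open>s\<close> tend to
  \<open>1\<close>, where \<open>c\<close> tends to \<open>0\<close>.
\<close>

lemma duality_interior:
  assumes s: "0 < s" "s < 1"
  shows "F_pn p n s + k / n * F_pn q k ((1 - s ^ n) powr (1 / k)) = pi_pn p n / 2"
proof -
  define \<Phi> where "\<Phi> = (\<lambda>s. F_pn p n s + k / n * F_pn q k ((1 - s ^ n) powr (1 / k)))"
  have lim_c: "((\<lambda>t::real. (1 - t ^ n) powr (1 / k)) \<longlongrightarrow> 0) (at_left 1)"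
  proof -
    have "((\<lambda>t::real. 1 - t ^ n) \<longlongrightarrow> 1 - 1 ^ n) (at_left 1)" by (intro tendsto_intros)
    then have "((\<lambda>t::real. 1 - t ^ n) \<longlongrightarrow> 0) (at_left 1)" by simp
    moreover have "eventually (\<lambda>t::real. t \<in> {0<..<1}) (at_left 1)" by (intro eventually_at_left_real) simp
    then have "eventually (\<lambda>t::real. 0 \<le> 1 - t ^ n) (at_left 1)"
      by eventually_elim (auto intro: power_le_one)
    ultimately show ?thesis using tendsto_powr'[of "\<lambda>t. 1 - t ^ n" 0 "at_left 1" "\<lambda>_. 1 / real k" "1 / real k"] k by simp
  qed
  have "isCont (F_pn q k) 0"
    using F_pn_has_derivative[of k 0 q] k by (auto simp: zero_power intro: DERIV_isCont)
  then have "(\<Phi> \<longlongrightarrow> pi_pn p n / 2 + k / n * F_pn q k 0) (at_left 1)"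
    unfolding \<Phi>_def
    by (intro tendsto_intros F_pn_tendsto_1 F.p F.n_pos isCont_tendsto_compose[OF _ lim_c])
  then have lim: "(\<Phi> \<longlongrightarrow> pi_pn p n / 2) (at_left 1)" by (simp add: F_pn_0)
  have deriv: "(\<Phi> has_real_derivative 0) (at t)" if t: "t \<in> {0<..<1}" for t
  proof -
    have tn: "t ^ n < 1" "0 < t ^ n" using t n by (auto simp: power_less_one_iff)
    define c where "c = (1 - t ^ n) powr (1 / k)"
    have ck: "c ^ k = 1 - t ^ n" using tn by (simp add: c_def powr_root_power)
    have c': "((\<lambda>t. (1 - t ^ n) powr (1 / k)) has_real_derivative
        1 / k * (1 - t ^ n) powr (1 / k - 1) * - (n * t ^ (n - 1))) (at t)"
      using tn by (intro DERIV_chain'[OF _ has_real_derivative_powr]) (auto intro!: derivative_eq_intros)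
    have "(F_pn q k has_real_derivative 1 / (t ^ n) powr (1 / q)) (at c)"
      using F_pn_has_derivative[of k c q] tn ck k by simp
    from DERIV_chain'[OF c' this[unfolded c_def]] F_pn_has_derivative[OF F.n_pos tn(1), of p]
    have "(\<Phi> has_real_derivative 1 / (1 - t ^ n) powr (1 / p) + k / n *
        (1 / (t ^ n) powr (1 / q) * (1 / k * (1 - t ^ n) powr (1 / k - 1) * - (n * t ^ (n - 1))))) (at t)"
      unfolding \<Phi>_def by (intro DERIV_add DERIV_cmult)
    also have "k / n * (1 / (t ^ n) powr (1 / q) * (1 / k * (1 - t ^ n) powr (1 / k - 1) * - (n * t ^ (n - 1))))
        = - ((1 - t ^ n) powr (1 / k - 1) * (1 / (t ^ n) powr (1 / q) * t ^ (n - 1)))"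
      using n k by simp
    also have "\<dots> = - (1 / (1 - t ^ n) powr (1 / p))"
      using t power_powr_inverse_q[of t] by (simp add: inverse_exponents flip: powr_minus_divide)
    finally show ?thesis by simp
  qed
  have "eventually (\<lambda>t. t \<in> {0<..<1}) (at_left (1::real))" by (intro eventually_at_left_real) simp
  then have "eventually (\<lambda>t. \<Phi> t = \<Phi> s) (at_left 1)"
    by eventually_elim (rule DERIV_isconst3[of 0 1], use deriv s in auto)
  then have "(\<Phi> \<longlongrightarrow> \<Phi> s) (at_left 1)" by (rule tendsto_eventually)
  then have "\<Phi> s = pi_pn p n / 2" using lim by (intro tendsto_unique) auto
  then show ?thesis by (simp add: \<Phi>_def)
qed

text \<open>
  The other end \<open>s \<rightarrow> 0\<close>, \<open>c \<rightarrow> 1\<close> of the quarter period in the same identity.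
\<close>

lemma pi_duality: "k * pi_pn q k = n * pi_pn p n"
proof -
  have lim_c: "((\<lambda>t::real. (1 - t ^ n) powr (1 / k)) \<longlongrightarrow> 1) (at_right 0)"
  proof -
    have "((\<lambda>t::real. (1 - t ^ n) powr (1 / k)) \<longlongrightarrow> (1 - 0 ^ n) powr (1 / k)) (at_right 0)"
      using n by (intro tendsto_intros) (auto simp: zero_power)
    then show ?thesis using n by (simp add: zero_power)
  qed
  have ev: "eventually (\<lambda>t. t \<in> {0<..<1}) (at_right (0::real))" by (intro eventually_at_right_real) simp
  have "filterlim (\<lambda>t. (1 - t ^ n) powr (1 / k)) (at_left 1) (at_right (0::real))"
    unfolding filterlim_at
  proof (intro conjI lim_c)
    show "eventually (\<lambda>t. (1 - t ^ n) powr (1 / k) \<in> {..<1} \<and> (1 - t ^ n) powr (1 / k) \<noteq> 1) (at_right (0::real))"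
      using ev
    proof eventually_elim
      case (elim t)
      then have "(1 - t ^ n) powr (1 / k) < 1 powr (1 / k)"
        using k n by (intro powr_less_mono2) (auto simp: power_less_one_iff less_imp_le)
      then show ?case by simp
    qed
  qed
  from filterlim_compose[OF F_pn_tendsto_1[OF G.p G.n_pos] this]
  have "((\<lambda>t. F_pn q k ((1 - t ^ n) powr (1 / k))) \<longlongrightarrow> pi_pn q k / 2) (at_right 0)" .
  moreover have "isCont (F_pn p n) 0"
    using F_pn_has_derivative[of n 0 p] n by (auto simp: zero_power intro: DERIV_isCont)
  then have "(F_pn p n \<longlongrightarrow> 0) (at_right 0)"
    by (simp add: isCont_def F_pn_0 filterlim_at_split)
  ultimately have "((\<lambda>s. F_pn p n s + k / n * F_pn q k ((1 - s ^ n) powr (1 / k))) \<longlongrightarrow> 0 + k / n * (pi_pn q k / 2)) (at_right 0)"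
    by (intro tendsto_intros)
  moreover have "((\<lambda>s. F_pn p n s + k / n * F_pn q k ((1 - s ^ n) powr (1 / k))) \<longlongrightarrow> pi_pn p n / 2) (at_right 0)"
    by (rule tendsto_eventually, rule eventually_mono[OF ev]) (use duality_interior in auto)
  ultimately have "k / n * (pi_pn q k / 2) = pi_pn p n / 2"
    using tendsto_unique[OF trivial_limit_at_right_real] by fastforce
  then show ?thesis using n by (simp add: field_simps)
qed

text \<open>
  The argument at which the dual sine takes the value \<open>c x\<close>. It is \<open>0\<close> at \<open>x = pi_pn p n / 2\<close>.
\<close>

definition dual_time :: "real \<Rightarrow> real" where
  "dual_time x = n / k * (pi_pn p n / 2 - x)"

text \<open>
  The time at which the dual sine arrives at the left end of its domain.
\<close>

definition right_end :: real where
  "right_end = pi_pn p n / 2 - k / n * sin_left_end q k"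

definition upper_sin :: "real \<Rightarrow> real" where
  "upper_sin x = (1 - sin_pn q k (dual_time x) ^ k) powr (1 / n)"

lemma dual_time_bounds:
  "sin_left_end q k < dual_time x \<longleftrightarrow> x < right_end"
  "dual_time x < pi_pn q k / 2 \<longleftrightarrow> 0 < x"
proof -
  have nk: "real n > 0" "real k > 0" using n k by auto
  show "sin_left_end q k < dual_time x \<longleftrightarrow> x < right_end"
    using nk by (simp add: dual_time_def right_end_def field_simps)
  have "pi_pn q k / 2 = n / k * (pi_pn p n / 2)"
    using pi_duality nk by (simp add: field_simps)
  then have "dual_time x < pi_pn q k / 2 \<longleftrightarrow> n / k * (pi_pn p n / 2 - x) < n / k * (pi_pn p n / 2)"
    by (simp add: dual_time_def)
  also have "\<dots> \<longleftrightarrow> 0 < x" using nk by (subst mult_less_cancel_left_pos) auto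
  finally show "dual_time x < pi_pn q k / 2 \<longleftrightarrow> 0 < x" .
qed

lemma right_end_gt: "pi_pn p n / 2 < right_end"
proof -
  have "k / n * sin_left_end q k < 0" using n k by (intro mult_pos_neg G.left_end_neg) auto
  then show ?thesis unfolding right_end_def by linarith
qed

lemma upper_sin_analytic:
  assumes "0 < x" "x < right_end"
  shows "real_analytic_on upper_sin {x}"
proof -
  have eq: "dual_time t = n / k * (pi_pn p n / 2) + - (n / k) * t" for t
    by (simp add: dual_time_def algebra_simps)
  have "real_analytic_on (\<lambda>t. (1 - sin_pn q k t ^ k) powr (1 / n)) {dual_time x}"
    using assms dual_time_bounds by (intro G.cos_analytic) auto
  from real_analytic_at_affine[OF this[unfolded eq]] n k show ?thesis
    by (simp add: upper_sin_def[abs_def] eq)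
qed

lemma upper_sin_eq:
  assumes "0 < x" "x \<le> pi_pn p n / 2"
  shows "upper_sin x = sin_pn p n x"
proof (cases "x = pi_pn p n / 2")
  case True
  have "sin_pn q k 0 = 0"
    using G.sin_F[of 0] k by (simp add: F_pn_0 zero_power)
  moreover have "dual_time x = 0" using True by (simp add: dual_time_def)
  moreover have "sin_pn p n x = 1" using True F.sin_right by (simp only:)
  ultimately show ?thesis using k by (simp add: upper_sin_def zero_power)
next
  case False
  define y where "y = sin_pn p n x"
  have x: "sin_left_end p n < x" "x < pi_pn p n / 2" using assms False F.left_end_neg by auto
  have y: "y ^ n < 1" "F_pn p n y = x" using F.sin_interior[OF x] by (auto simp: y_def)
  have y0: "0 < y"
  proof (rule ccontr)
    assume "\<not> 0 < y"
    then have "F_pn p n y \<le> F_pn p n 0"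
      using F_pn_less_interior[OF F.n_pos y(1), of 0 p] n by (cases "y = 0") (auto simp: zero_power)
    then show False using y assms by (simp add: F_pn_0)
  qed
  then have y1: "y < 1" using y(1) n by (simp add: power_less_one_iff)
  define c where "c = (1 - y ^ n) powr (1 / k)"
  have ck: "c ^ k = 1 - y ^ n" using y by (simp add: c_def powr_root_power)
  have "x + k / n * F_pn q k c = pi_pn p n / 2"
    using duality_interior[OF y0 y1] y(2) by (simp add: c_def)
  then have "F_pn q k c = dual_time x" using n k by (simp add: dual_time_def field_simps)
  then have "sin_pn q k (dual_time x) = c"
    using G.sin_F[of c] ck y0 by simp
  then show ?thesis using ck y0 power_powr_root[of y] by (simp add: upper_sin_def y_def)
qed

text \<open>
  At \<open>pi_pn p n / 2\<close> itself \<open>sin_pn p n\<close> takes the right value but is defined only to one side;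
  around that point the analytic description is \<open>upper_sin\<close>, which agrees on the overlap.
\<close>

definition glued_sin :: "real \<Rightarrow> real" where
  "glued_sin x = (if x \<le> pi_pn p n / 2 then sin_pn p n x else upper_sin x)"

lemma glued_sin_upper: "0 < x \<Longrightarrow> glued_sin x = upper_sin x"
  using upper_sin_eq by (simp add: glued_sin_def)

lemma glued_sin_analytic: "real_analytic_on glued_sin {sin_left_end p n<..<right_end}"
proof (subst real_analytic_on_iff_at, safe)
  fix x assume x: "x \<in> {sin_left_end p n<..<right_end}"
  show "real_analytic_on glued_sin {x}"
  proof (cases "x < pi_pn p n / 2")
    case True
    show ?thesis
      by (rule real_analytic_at_cong_open[of "sin_pn p n" _ "{..<pi_pn p n / 2}"])
         (use True x F.sin_analytic[of x] in \<open>auto simp: glued_sin_def\<close>)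
  next
    case False
    then have "0 < x" using F.pi_pos by simp
    show ?thesis
      by (rule real_analytic_at_cong_open[of upper_sin _ "{0<..}"])
         (use x \<open>0 < x\<close> upper_sin_analytic[of x] glued_sin_upper in auto)
  qed
qed

lemma glued_sin_at_bot:
  assumes "odd n"
  shows "filterlim glued_sin at_bot (at_right (sin_left_end p n))"
proof -
  have "eventually (\<lambda>t. t \<in> {sin_left_end p n<..<0}) (at_right (sin_left_end p n))"
    using F.left_end_neg by (intro eventually_at_right_real)
  then have "eventually (\<lambda>t. glued_sin t = sin_pn p n t) (at_right (sin_left_end p n))"
    by eventually_elim (use F.pi_pos in \<open>auto simp: glued_sin_def\<close>)
  with F.sin_tendsto_at_bot[OF assms] show ?thesis
    by (simp only: filterlim_cong[OF refl refl])
qed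

lemma glued_sin_at_top:
  assumes "odd k"
  shows "filterlim glued_sin at_top (at_left right_end)"
proof -
  have "filterlim dual_time (at_right (sin_left_end q k)) (at_left right_end)"
    unfolding filterlim_at
  proof
    have "dual_time right_end = sin_left_end q k"
      using n k by (simp add: dual_time_def right_end_def)
    moreover have "(dual_time \<longlongrightarrow> dual_time right_end) (at_left right_end)"
      unfolding dual_time_def[abs_def] by (intro tendsto_intros)
    ultimately show "(dual_time \<longlongrightarrow> sin_left_end q k) (at_left right_end)" by simp
    have "eventually (\<lambda>t. t < right_end) (at_left right_end)"
      by (simp add: eventually_at_filter)
    then show "eventually (\<lambda>t. dual_time t \<in> {sin_left_end q k<..} \<and> dual_time t \<noteq> sin_left_end q k) (at_left right_end)"
    proof eventually_elim
      case (elim t)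
      then show ?case using dual_time_bounds(1)[of t] by auto
    qed
  qed
  from filterlim_compose[OF G.sin_tendsto_at_bot[OF assms] this]
  have "filterlim (\<lambda>t. - sin_pn q k (dual_time t)) at_top (at_left right_end)"
    by (simp add: filterlim_uminus_at_top)
  then have "filterlim (\<lambda>t. (- sin_pn q k (dual_time t)) ^ k) at_top (at_left right_end)"
    using k by (intro filterlim_pow_at_top) auto
  then have "filterlim (\<lambda>t. 1 + (- sin_pn q k (dual_time t)) ^ k) at_top (at_left right_end)"
    by (intro filterlim_tendsto_add_at_top[OF tendsto_const])
  then have "filterlim (\<lambda>t. 1 - sin_pn q k (dual_time t) ^ k) at_top (at_left right_end)"
    using assms by (simp add: power_minus_odd)
  then have "filterlim upper_sin at_top (at_left right_end)"
    unfolding upper_sin_def[abs_def] using n by (intro filterlim_powr_at_top) auto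
  moreover have "eventually (\<lambda>t. t \<in> {0<..<right_end}) (at_left right_end)"
    using right_end_gt F.pi_pos by (intro eventually_at_left_real) auto
  then have "eventually (\<lambda>t. glued_sin t = upper_sin t) (at_left right_end)"
    by eventually_elim (simp add: glued_sin_upper)
  ultimately show ?thesis by (simp only: filterlim_cong[OF refl refl])
qed

lemma right_end_even:
  assumes "even k"
  shows "right_end = pi_pn p n"
proof -
  have "k / n * (pi_pn q k / 2) = (k * pi_pn q k) / (2 * n)" by simp
  also have "\<dots> = pi_pn p n / 2" unfolding pi_duality using n by simp
  finally have "k / n * (pi_pn q k / 2) = pi_pn p n / 2" .
  moreover have "right_end = pi_pn p n / 2 + k / n * (pi_pn q k / 2)"
    using assms unfolding right_end_def sin_left_end_def by (simp only: if_True mult_minus_right diff_minus_eq_add)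
  ultimately show ?thesis by linarith
qed

text \<open>
  Reflection about \<open>pi_pn p n / 2\<close> changes the sign of the dual sine, and only its \<open>k\<close>-th power
  enters.
\<close>

lemma glued_sin_reflect:
  assumes "even k" "0 < x" "x < pi_pn p n"
  shows "glued_sin (pi_pn p n - x) = glued_sin x"
proof -
  have "dual_time (pi_pn p n - x) = - dual_time x"
    by (simp add: dual_time_def algebra_simps)
  moreover have "sin_pn q k (- dual_time x) = - sin_pn q k (dual_time x)"
  proof (rule G.sin_minus[OF assms(1)])
    show "- (pi_pn q k / 2) \<le> dual_time x" "dual_time x \<le> pi_pn q k / 2"
      using dual_time_bounds[of x] assms right_end_even by (auto simp: sin_left_end_def)
  qed
  ultimately have "upper_sin (pi_pn p n - x) = upper_sin x"
    using assms(1) by (simp add: upper_sin_def)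
  then show ?thesis using assms by (simp add: glued_sin_upper)
qed

text \<open>
  For \<open>k\<close> odd the part of the curve with \<open>c < 0\<close> is parametrised by \<open>s = u > 1\<close>. The
  elapsed time \<open>T\<close> as a function of \<open>u\<close> is an antiderivative of the integrand of \<open>mu\<close>. It grows from
  \<open>pi_pn p n / 2\<close> at \<open>u = 1\<close> to \<open>right_end\<close> at \<open>u = \<infinity>\<close>.
\<close>

lemma right_end_odd:
  assumes "odd k"
  shows "right_end = pi_pn p n / 2 + mu k n"
proof -
  define c where "c = (\<lambda>u::real. - ((u ^ n - 1) powr (1 / k)))"
  define T where "T = (\<lambda>u. pi_pn p n / 2 - k / n * F_pn q k (c u))"
  have un: "1 < u ^ n" if "1 < u" for u :: real using that n by (intro one_less_power) auto
  have ck: "c u ^ k = 1 - u ^ n" if "1 < u" for u :: real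
    using un[OF that] assms by (simp add: c_def powr_root_power power_minus_odd)
  have c': "(c has_real_derivative - (1 / k * (u ^ n - 1) powr (1 / k - 1) * (n * u ^ (n - 1)))) (at u)"
    if "1 < u" for u :: real
    unfolding c_def using un[OF that]
    by (intro DERIV_minus DERIV_chain'[OF _ has_real_derivative_powr]) (auto intro!: derivative_eq_intros)
  have T': "(T has_real_derivative 1 / (u ^ n - 1) powr ((real k - 1) / k)) (at u)" if u: "1 < u" for u :: real
  proof -
    have "(F_pn q k has_real_derivative 1 / (u ^ n) powr (1 / q)) (at (c u))"
      using F_pn_has_derivative[of k "c u" q] un[OF u] ck[OF u] k by simp
    from DERIV_chain'[OF c'[OF u] this]
    have "(T has_real_derivative 0 - k / n * (1 / (u ^ n) powr (1 / q) *
        - (1 / k * (u ^ n - 1) powr (1 / k - 1) * (n * u ^ (n - 1))))) (at u)"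
      unfolding T_def by (intro DERIV_diff DERIV_const DERIV_cmult)
    also have "0 - k / n * (1 / (u ^ n) powr (1 / q) * - (1 / k * (u ^ n - 1) powr (1 / k - 1) * (n * u ^ (n - 1))))
       = (u ^ n - 1) powr (1 / k - 1) * (1 / (u ^ n) powr (1 / q) * u ^ (n - 1))"
      using n k by simp
    also have "\<dots> = (u ^ n - 1) powr (1 / k - 1)"
      using power_powr_inverse_q[of u] u by simp
    also have "1 / k - 1 = - ((real k - 1) / k)" using k by (simp add: field_simps)
    finally show ?thesis by (simp add: powr_minus_divide)
  qed
  have "(c \<longlongrightarrow> 0) (at_right 1)"
  proof -
    have "((\<lambda>t::real. t ^ n - 1) \<longlongrightarrow> 1 ^ n - 1) (at_right 1)" by (intro tendsto_intros)
    then have "((\<lambda>t::real. t ^ n - 1) \<longlongrightarrow> 0) (at_right 1)" by simp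
    moreover have "eventually (\<lambda>t::real. 0 \<le> t ^ n - 1) (at_right 1)"
      by (auto simp: eventually_at_filter intro!: always_eventually)
    ultimately have "((\<lambda>t::real. (t ^ n - 1) powr (1 / k)) \<longlongrightarrow> 0) (at_right 1)"
      using tendsto_powr'[of "\<lambda>t. t ^ n - 1" 0 "at_right 1" "\<lambda>_. 1 / real k" "1 / real k"] k by simp
    from tendsto_minus[OF this] show ?thesis by (simp add: c_def)
  qed
  moreover have "isCont (F_pn q k) 0"
    using F_pn_has_derivative[of k 0 q] k by (auto simp: zero_power intro: DERIV_isCont)
  ultimately have "(T \<longlongrightarrow> pi_pn p n / 2 - k / n * F_pn q k 0) (at_right 1)"
    unfolding T_def by (intro tendsto_intros isCont_tendsto_compose[of 0 "F_pn q k"])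
  then have lim1: "(T \<longlongrightarrow> pi_pn p n / 2) (at_right 1)" by (simp add: F_pn_0)
  have "filterlim (\<lambda>u::real. u ^ n) at_top at_top"
    using n by (intro filterlim_pow_at_top filterlim_ident) auto
  then have "filterlim (\<lambda>u::real. - 1 + u ^ n) at_top at_top"
    by (intro filterlim_tendsto_add_at_top[OF tendsto_const])
  then have "filterlim (\<lambda>u::real. (- 1 + u ^ n) powr (1 / k)) at_top at_top"
    using k by (intro filterlim_powr_at_top) auto
  then have "filterlim c at_bot at_top"
    by (simp add: c_def filterlim_uminus_at_bot)
  moreover have "(F_pn q k \<longlongrightarrow> sin_left_end q k) at_bot"
    using G.F_tendsto_left_end assms by simp
  ultimately have "((\<lambda>u. F_pn q k (c u)) \<longlongrightarrow> sin_left_end q k) at_top"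
    by (rule filterlim_compose[rotated])
  then have lim2: "(T \<longlongrightarrow> right_end) at_top"
    unfolding T_def right_end_def by (intro tendsto_intros)
  have cont: "isCont (\<lambda>u. 1 / (u ^ n - 1) powr ((real k - 1) / k)) u" if "1 < u" for u :: real
    using un[OF that] by (intro continuous_intros) auto
  have "(LBINT u=ereal 1..\<infinity>. 1 / (u ^ n - 1) powr ((real k - 1) / k)) = right_end - pi_pn p n / 2"
    using lim1 lim2 T' cont
    by (intro interval_integral_FTC_nonneg) (auto simp: ereal_tendsto_simps)
  then show ?thesis by (simp add: mu_def one_ereal_def)
qed

end

section \<open>Maximal intervals in the four cases\<close>

context curve_params
begin

lemma glued_sin_analytic_at:
  assumes "sin_left_end p n < x" "x < right_end"
  shows "real_analytic_on glued_sin {x}"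
  using glued_sin_analytic assms by (subst (asm) real_analytic_on_iff_at) auto

lemma maximal_odd_odd:
  assumes "odd k" "odd n"
  shows "maximal_analytic_interval (sin_pn p n) (sin_dom p n) {sin_left_end p n<..<right_end}"
proof (rule maximal_analytic_intervalI_blowup[where s = glued_sin and c = "sin_left_end p n" and d = 0])
  show "sin_dom p n \<subseteq> {sin_left_end p n<..<right_end}"
    using right_end_gt assms by (auto simp: F.sin_dom_eq)
  show "glued_sin x = sin_pn p n x" if "x \<in> sin_dom p n" for x
    using that assms by (auto simp: F.sin_dom_eq glued_sin_def)
  show "{sin_left_end p n<..<0} \<subseteq> sin_dom p n"
    using F.pi_pos assms by (auto simp: F.sin_dom_eq)
  show "filterlim glued_sin at_infinity (at_right (sin_left_end p n))"
    using glued_sin_at_bot[OF assms(2)] at_bot_le_at_infinity by (rule filterlim_mono) simp_all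
  show "filterlim glued_sin at_infinity (at_left right_end)"
    using glued_sin_at_top[OF assms(1)] at_top_le_at_infinity by (rule filterlim_mono) simp_all
qed (use F.left_end_neg glued_sin_analytic in auto)

text \<open>
  Reflecting at \<open>h = pi_pn p n / 2\<close> carries the blow-up at the left end to the right end. Near \<open>h\<close>
  both branches are \<open>glued_sin\<close>, by its symmetry on \<open>(0, 2 * h)\<close>.
\<close>

lemma maximal_even_odd:
  assumes "even k" "odd n"
  shows "maximal_analytic_interval (sin_pn p n) (sin_dom p n)
    {sin_left_end p n<..<pi_pn p n - sin_left_end p n}"
proof -
  define a where "a = sin_left_end p n"
  define h where "h = pi_pn p n / 2"
  define s where "s = (\<lambda>x. if x \<le> h then glued_sin x else glued_sin (2 * h - x))"
  have a: "a < 0" and h: "0 < h" using F.left_end_neg F.pi_pos by (auto simp: a_def h_def)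
  have re: "right_end = 2 * h" using right_end_even[OF assms(1)] by (simp add: h_def)
  have reflected: "real_analytic_on (\<lambda>t. glued_sin (2 * h - t)) {x}" if "h < x" "x < 2 * h - a" for x
    using real_analytic_at_affine[of glued_sin "2 * h" "-1" x] glued_sin_analytic_at[of "2 * h - x"]
      that h re by (simp add: a_def)
  have analytic: "real_analytic_on s {a<..<2 * h - a}"
  proof (subst real_analytic_on_iff_at, safe)
    fix x assume x: "x \<in> {a<..<2 * h - a}"
    consider "x < h" | "x = h" | "h < x" by linarith
    then show "real_analytic_on s {x}"
    proof cases
      case 1
      show ?thesis
        by (rule real_analytic_at_cong_open[of glued_sin _ "{..<h}"])
           (use 1 x h re glued_sin_analytic_at[of x] in \<open>auto simp: s_def a_def\<close>)
    next
      case 2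
      show ?thesis
        by (rule real_analytic_at_cong_open[of glued_sin _ "{0<..<2 * h}"])
           (use 2 x h re glued_sin_analytic_at[of x] glued_sin_reflect[OF assms(1)]
             in \<open>auto simp: s_def a_def h_def\<close>)
    next
      case 3
      show ?thesis
        by (rule real_analytic_at_cong_open[of "\<lambda>t. glued_sin (2 * h - t)" _ "{h<..}"])
           (use 3 x reflected[of x] in \<open>auto simp: s_def\<close>)
    qed
  qed
  have left: "filterlim glued_sin at_infinity (at_right a)"
    unfolding a_def using glued_sin_at_bot[OF assms(2)] at_bot_le_at_infinity
    by (rule filterlim_mono) simp_all
  have "eventually (\<lambda>t. t \<in> {a<..<h}) (at_right a)"
    using a h by (intro eventually_at_right_real) auto
  then have "eventually (\<lambda>t. s t = glued_sin t) (at_right a)"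
    by eventually_elim (simp add: s_def)
  with left have s_left: "filterlim s at_infinity (at_right a)"
    by (simp only: filterlim_cong[OF refl refl])
  have "filterlim (\<lambda>t. 2 * h - t) (at_right a) (at_left (2 * h - a))"
    unfolding filterlim_at
  proof
    have "((\<lambda>t. 2 * h - t) \<longlongrightarrow> 2 * h - (2 * h - a)) (at_left (2 * h - a))"
      by (intro tendsto_intros)
    then show "((\<lambda>t. 2 * h - t) \<longlongrightarrow> a) (at_left (2 * h - a))" by simp
    have "eventually (\<lambda>t. t < 2 * h - a) (at_left (2 * h - a))" by (simp add: eventually_at_filter)
    then show "eventually (\<lambda>t. 2 * h - t \<in> {a<..} \<and> 2 * h - t \<noteq> a) (at_left (2 * h - a))"
      by eventually_elim auto
  qed
  from filterlim_compose[OF left this]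
  have right: "filterlim (\<lambda>t. glued_sin (2 * h - t)) at_infinity (at_left (2 * h - a))" .
  have "eventually (\<lambda>t. t \<in> {h<..<2 * h - a}) (at_left (2 * h - a))"
    using a h by (intro eventually_at_left_real) auto
  then have "eventually (\<lambda>t. s t = glued_sin (2 * h - t)) (at_left (2 * h - a))"
    by eventually_elim (simp add: s_def)
  with right have s_right: "filterlim s at_infinity (at_left (2 * h - a))"
    by (simp only: filterlim_cong[OF refl refl])
  have "maximal_analytic_interval (sin_pn p n) (sin_dom p n) {a<..<2 * h - a}"
  proof (rule maximal_analytic_intervalI_blowup[where s = s and c = a and d = 0])
    show "sin_dom p n \<subseteq> {a<..<2 * h - a}" "{a<..<0} \<subseteq> sin_dom p n"
      using a h assms by (auto simp: F.sin_dom_eq a_def h_def)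
    show "s x = sin_pn p n x" if "x \<in> sin_dom p n" for x
      using that assms by (auto simp: F.sin_dom_eq s_def glued_sin_def h_def)
  qed (use a analytic s_left s_right in auto)
  then show ?thesis by (simp add: a_def h_def)
qed

text \<open>
  The odd extension of \<open>glued_sin\<close> from the right half-line; near \<open>0\<close> it is \<open>sin_pn p n\<close>, which is odd.
\<close>

lemma maximal_odd_even:
  assumes "odd k" "even n"
  shows "maximal_analytic_interval (sin_pn p n) (sin_dom p n) {- right_end<..<right_end}"
proof -
  define h where "h = pi_pn p n / 2"
  define s where "s = (\<lambda>x. if x < 0 then - glued_sin (- x) else glued_sin x)"
  have h: "0 < h" and re: "h < right_end" using F.pi_pos right_end_gt by (auto simp: h_def)
  have le: "sin_left_end p n = - h" using assms by (simp add: sin_left_end_def h_def)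
  have odd: "- glued_sin (- x) = glued_sin x" if "- h \<le> x" "x \<le> h" for x
    using F.sin_minus[OF assms(2), of x] that by (simp add: glued_sin_def h_def)
  have reflected: "real_analytic_on (\<lambda>t. - glued_sin (- t)) {x}" if "- right_end < x" "x < 0" for x
    using real_analytic_at_cmult[OF real_analytic_at_affine[of glued_sin 0 "-1" x], of "- 1"]
      glued_sin_analytic_at[of "- x"] that h le by simp
  have analytic: "real_analytic_on s {- right_end<..<right_end}"
  proof (subst real_analytic_on_iff_at, safe)
    fix x assume x: "x \<in> {- right_end<..<right_end}"
    consider "x < 0" | "x = 0" | "0 < x" by linarith
    then show "real_analytic_on s {x}"
    proof cases
      case 1
      show ?thesis
        by (rule real_analytic_at_cong_open[of "\<lambda>t. - glued_sin (- t)" _ "{..<0}"])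
           (use 1 x reflected[of x] in \<open>auto simp: s_def\<close>)
    next
      case 2
      show ?thesis
        by (rule real_analytic_at_cong_open[of glued_sin _ "{-h<..<h}"])
           (use 2 x h le re glued_sin_analytic_at[of x] odd in \<open>auto simp: s_def\<close>)
    next
      case 3
      show ?thesis
        by (rule real_analytic_at_cong_open[of glued_sin _ "{0<..}"])
           (use 3 x h le glued_sin_analytic_at[of x] in \<open>auto simp: s_def\<close>)
    qed
  qed
  have top: "filterlim glued_sin at_top (at_left right_end)" by (rule glued_sin_at_top[OF assms(1)])
  have "eventually (\<lambda>t. t \<in> {0<..<right_end}) (at_left right_end)"
    using h re by (intro eventually_at_left_real) auto
  then have "eventually (\<lambda>t. s t = glued_sin t) (at_left right_end)"
    by eventually_elim (simp add: s_def)
  moreover have "filterlim glued_sin at_infinity (at_left right_end)"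
    using top at_top_le_at_infinity by (rule filterlim_mono) simp_all
  ultimately have s_right: "filterlim s at_infinity (at_left right_end)"
    by (simp only: filterlim_cong[OF refl refl])
  have "filterlim uminus (at_left right_end) (at_right (- right_end))"
    by (simp add: at_right_minus filterlim_def filtermap_filtermap)
  from filterlim_compose[OF top this]
  have "filterlim (\<lambda>t. - glued_sin (- t)) at_bot (at_right (- right_end))"
    by (simp add: filterlim_uminus_at_bot)
  then have "filterlim (\<lambda>t. - glued_sin (- t)) at_infinity (at_right (- right_end))"
    using at_bot_le_at_infinity by (rule filterlim_mono) simp_all
  moreover have "eventually (\<lambda>t. t \<in> {- right_end<..<0}) (at_right (- right_end))"
    using h re by (intro eventually_at_right_real) auto
  then have "eventually (\<lambda>t. s t = - glued_sin (- t)) (at_right (- right_end))"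
    by eventually_elim (simp add: s_def)
  ultimately have s_left: "filterlim s at_infinity (at_right (- right_end))"
    by (simp only: filterlim_cong[OF refl refl])
  show ?thesis
  proof (rule maximal_analytic_intervalI_blowup[where s = s and c = "- h" and d = h])
    show "sin_dom p n \<subseteq> {- right_end<..<right_end}" "{- h<..<h} \<subseteq> sin_dom p n"
      using h re assms le by (auto simp: F.sin_dom_eq h_def)
    show "s x = sin_pn p n x" if "x \<in> sin_dom p n" for x
      using that assms odd[of x] le by (auto simp: F.sin_dom_eq s_def glued_sin_def h_def)
  qed (use h analytic s_left s_right in auto)
qed

text \<open>
  Oddness and the symmetry about \<open>h = pi_pn p n / 2\<close> give \<open>s (x + 2 * h) = - s x\<close>, which prescribes
  the extension. The translates of \<open>(- h, h]\<close> partition the line and determine the definition by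
  the index \<open>j\<close>. Its analyticity is checked on the translates of \<open>(- h, 2 * h)\<close>: these are open
  and overlap, and \<open>s_eq\<close> shows that the definition is given by the same formula on the whole of
  each of them.
\<close>

lemma maximal_even_even:
  assumes "even k" "even n"
  shows "maximal_analytic_interval (sin_pn p n) (sin_dom p n) UNIV"
proof -
  define h where "h = pi_pn p n / 2"
  define sg where "sg = (\<lambda>j::int. if even j then 1 else - 1 :: real)"
  define j where "j = (\<lambda>x. \<lceil>(x - h) / (2 * h)\<rceil>)"
  define s where "s = (\<lambda>x. sg (j x) * glued_sin (x - j x * (2 * h)))"
  have h: "0 < h" using F.pi_pos by (simp add: h_def)
  have le: "sin_left_end p n = - h" using assms by (simp add: sin_left_end_def h_def)
  have re: "right_end = 2 * h" using right_end_even[OF assms(1)] by (simp add: h_def)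
  have odd: "glued_sin (- x) = - glued_sin x" if "- h \<le> x" "x \<le> h" for x
    using F.sin_minus[OF assms(2), of x] that by (simp add: glued_sin_def h_def)
  have j_eq: "j x = i" if "- h < x - i * (2 * h)" "x - i * (2 * h) \<le> h" for x and i :: int
    unfolding j_def by (rule ceiling_unique) (use that h in \<open>simp_all add: field_simps\<close>)
  have s_eq: "s x = sg i * glued_sin (x - i * (2 * h))"
    if x: "- h < x - i * (2 * h)" "x - i * (2 * h) < 2 * h" for x and i :: int
  proof (cases "x - i * (2 * h) \<le> h")
    case True
    then show ?thesis using j_eq x by (simp add: s_def)
  next
    case False
    define u where "u = x - i * (2 * h)"
    have u: "h < u" "u < 2 * h" using False x by (auto simp: u_def)
    have shift: "x - real_of_int (i + 1) * (2 * h) = u - 2 * h" by (simp add: u_def algebra_simps)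
    then have "j x = i + 1" using u h by (intro j_eq) auto
    then have "s x = - sg i * glued_sin (u - 2 * h)"
      by (simp add: s_def shift[simplified] sg_def)
    also have "glued_sin (u - 2 * h) = - glued_sin (2 * h - u)"
      using odd[of "2 * h - u"] u h by simp
    also have "glued_sin (2 * h - u) = glued_sin u"
      using glued_sin_reflect[OF assms(1), of u] u h by (simp add: h_def)
    finally show ?thesis by (simp add: u_def)
  qed
  have "real_analytic_on s UNIV"
  proof (subst real_analytic_on_iff_at, safe)
    fix x
    define i where "i = j x"
    have i: "- h < x - i * (2 * h)" "x - i * (2 * h) \<le> h"
    proof -
      have "real_of_int i - 1 < (x - h) / (2 * h)" "(x - h) / (2 * h) \<le> i"
        using ceiling_correct[of "(x - h) / (2 * h)"] by (auto simp: i_def j_def)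
      then have "(real_of_int i - 1) * (2 * h) < x - h" "x - h \<le> i * (2 * h)"
        using h by (simp_all add: pos_less_divide_eq pos_divide_le_eq)
      then show "- h < x - i * (2 * h)" "x - i * (2 * h) \<le> h" by (simp_all add: algebra_simps)
    qed
    have "real_analytic_on glued_sin {x - i * (2 * h)}"
      using i h le re by (intro glued_sin_analytic_at) auto
    then have "real_analytic_on (\<lambda>t. sg i * glued_sin (t - i * (2 * h))) {x}"
      using real_analytic_at_cmult[OF real_analytic_at_affine[of glued_sin "- i * (2 * h)" 1 x]] by simp
    then show "real_analytic_on s {x}"
      by (rule real_analytic_at_cong_open[where U = "{i * (2 * h) - h<..<i * (2 * h) + 2 * h}"])
         (use i h s_eq in auto)
  qed
  moreover have "s x = sin_pn p n x" if "x \<in> sin_dom p n" for x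
  proof -
    have x: "- h \<le> x" "x \<le> h" using that assms le by (auto simp: F.sin_dom_eq h_def)
    show ?thesis
    proof (cases "x = - h")
      case True
      then have "s x = - glued_sin h" using s_eq[of x "- 1"] h by (simp add: sg_def)
      then show ?thesis using True F.sin_minus[OF assms(2), of h] h by (simp add: glued_sin_def h_def)
    next
      case False
      then show ?thesis using s_eq[of x 0] x h by (simp add: sg_def glued_sin_def h_def)
    qed
  qed
  ultimately show ?thesis
    unfolding maximal_analytic_interval_def extends_analytically_to_def by auto
qed

end

theorem theorem1p2:
  fixes p :: real and n :: nat and m :: int
  assumes "p > 1" and "n > 1" and "\<not> (p = 2 \<and> n = 2)"
    and "conj_exponent p = of_int m"
  shows
    "(even m \<and> even n \<longrightarrow>
        maximal_analytic_interval (sin_pn p n) (sin_dom p n) UNIV) \<and>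
     (even m \<and> odd n \<longrightarrow>
        maximal_analytic_interval (sin_pn p n) (sin_dom p n)
          {- nu (conj_exponent p) n <..< pi_pn p n + nu (conj_exponent p) n}) \<and>
     (odd m \<and> even n \<longrightarrow>
        maximal_analytic_interval (sin_pn p n) (sin_dom p n)
          {- (pi_pn p n / 2) - mu (conj_exponent p) n <..< pi_pn p n / 2 + mu (conj_exponent p) n}) \<and>
     (odd m \<and> odd n \<longrightarrow>
        maximal_analytic_interval (sin_pn p n) (sin_dom p n)
          {- nu (conj_exponent p) n <..< pi_pn p n / 2 + mu (conj_exponent p) n})"
proof -
  have "conj_exponent p > 1" using assms(1) by (simp add: conj_exponent_def field_simps)
  then have "m > 1" using assms(4) by simp
  define k where "k = nat m"
  have k_gt_1: "k > 1" and k_conj: "real k = conj_exponent p" and parity: "even m \<longleftrightarrow> even k"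
    using \<open>m > 1\<close> assms(4) by (auto simp: k_def even_nat_iff)
  have p_eq: "p = real k / (real k - 1)"
    using assms(1) unfolding k_conj by (simp add: conj_exponent_def field_simps)
  interpret curve_params p "real n / (real n - 1)" n k
    by unfold_locales (rule assms(2) k_gt_1 p_eq refl)+
  have left: "sin_left_end p n = - nu (conj_exponent p) n" if "odd n"
    using that by (simp add: sin_left_end_def)
  have right: "right_end = pi_pn p n / 2 + mu (conj_exponent p) n" if "odd k"
    using right_end_odd[OF that] k_conj by simp
  show ?thesis
    unfolding parity
  proof (intro conjI impI; elim conjE)
    show "maximal_analytic_interval (sin_pn p n) (sin_dom p n) UNIV" if "even k" "even n"
      using maximal_even_even[OF that] .
    show "maximal_analytic_interval (sin_pn p n) (sin_dom p n)
          {- nu (conj_exponent p) n <..< pi_pn p n + nu (conj_exponent p) n}" if "even k" "odd n"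
      using maximal_even_odd[OF that] left[OF that(2)] by simp
    show "maximal_analytic_interval (sin_pn p n) (sin_dom p n)
          {- (pi_pn p n / 2) - mu (conj_exponent p) n <..< pi_pn p n / 2 + mu (conj_exponent p) n}"
      if "odd k" "even n"
      using maximal_odd_even[OF that] right[OF that(1)] by simp
    show "maximal_analytic_interval (sin_pn p n) (sin_dom p n)
          {- nu (conj_exponent p) n <..< pi_pn p n / 2 + mu (conj_exponent p) n}" if "odd k" "odd n"
      using maximal_odd_odd[OF that] left[OF that(2)] right[OF that(1)] by simp
  qed
qed

end
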